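(* No model $\mathcal{M}$ of $\mathsf{ZF}$ has a proper end extension $\mathcal{N}$ satisfying $\mathsf{ZF}$ such that $\mathcal{N}$ is a conservative extension of $\mathcal{M}$.
   Context: $\mathcal{N}$ is an end extension of $\mathcal{M}$ if $\mathcal{M}\subseteq\mathcal{N}$ (submodel) and $\{x\in N: x\in^{\mathcal{N}}a\}=\{x\in M:x\in^{\mathcal{M}}a\}$ for all $a\in M$; proper means $M\neq N$. $\mathcal{N}$ is a conservative extension of $\mathcal{M}$ if for every parametrically $\mathcal{N}$-definable $D$, $D\cap M$ is parametrically $\mathcal{M}$-definable. *)

theory Defs
  imports Main
begin

datatype fm =
    Mem nat nat
  | Eq nat nat
  | Neg fm
  | Conj fm fm
  | Exists nat fm

abbreviation Disj :: "fm \<Rightarrow> fm \<Rightarrow> fm" where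
  "Disj p q \<equiv> Neg (Conj (Neg p) (Neg q))"

abbreviation Impl :: "fm \<Rightarrow> fm \<Rightarrow> fm" where
  "Impl p q \<equiv> Neg (Conj p (Neg q))"

abbreviation Iff :: "fm \<Rightarrow> fm \<Rightarrow> fm" where
  "Iff p q \<equiv> Conj (Impl p q) (Impl q p)"

abbreviation Forall :: "nat \<Rightarrow> fm \<Rightarrow> fm" where
  "Forall x p \<equiv> Neg (Exists x (Neg p))"

fun fv :: "fm \<Rightarrow> nat set" where
  "fv (Mem x y) = {x, y}"
| "fv (Eq x y) = {x, y}"
| "fv (Neg p) = fv p"
| "fv (Conj p q) = fv p \<union> fv q"
| "fv (Exists x p) = fv p - {x}"

record 'a eps_struct =
  carr :: "'a set"
  eps :: "'a \<Rightarrow> 'a \<Rightarrow> bool"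

text \<open>Only the restriction of \<open>eps\<close> to \<open>carr\<close> is ever relevant.\<close>

fun sat :: "'a eps_struct \<Rightarrow> (nat \<Rightarrow> 'a) \<Rightarrow> fm \<Rightarrow> bool" where
  "sat M s (Mem x y) \<longleftrightarrow> eps M (s x) (s y)"
| "sat M s (Eq x y) \<longleftrightarrow> s x = s y"
| "sat M s (Neg p) \<longleftrightarrow> \<not> sat M s p"
| "sat M s (Conj p q) \<longleftrightarrow> sat M s p \<and> sat M s q"
| "sat M s (Exists x p) \<longleftrightarrow> (\<exists>a\<in>carr M. sat M (s(x := a)) p)"

text \<open>Formulas with free variables are read as their universal closures. The domain must be
  required to be nonempty explicitly, as an empty one admits no assignments.\<close>

definition models :: "'a eps_struct \<Rightarrow> fm set \<Rightarrow> bool" where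
  "models M T \<longleftrightarrow> carr M \<noteq> {} \<and> (\<forall>p\<in>T. \<forall>s. range s \<subseteq> carr M \<longrightarrow> sat M s p)"

definition extensionality_ax :: fm where
  "extensionality_ax =
     Forall 0 (Forall 1 (Impl (Forall 2 (Iff (Mem 2 0) (Mem 2 1))) (Eq 0 1)))"

definition foundation_ax :: fm where
  "foundation_ax =
     Forall 0 (Impl (Exists 1 (Mem 1 0))
       (Exists 1 (Conj (Mem 1 0) (Neg (Exists 2 (Conj (Mem 2 0) (Mem 2 1)))))))"

definition pairing_ax :: fm where
  "pairing_ax =
     Forall 0 (Forall 1 (Exists 2 (Forall 3 (Iff (Mem 3 2) (Disj (Eq 3 0) (Eq 3 1))))))"

definition union_ax :: fm where
  "union_ax =
     Forall 0 (Exists 1 (Forall 2 (Iff (Mem 2 1) (Exists 3 (Conj (Mem 3 0) (Mem 2 3))))))"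

definition powerset_ax :: fm where
  "powerset_ax =
     Forall 0 (Exists 1 (Forall 2 (Iff (Mem 2 1) (Forall 3 (Impl (Mem 3 2) (Mem 3 0))))))"

definition infinity_ax :: fm where
  "infinity_ax =
     Exists 0 (Conj
       (Exists 1 (Conj (Mem 1 0) (Forall 2 (Neg (Mem 2 1)))))
       (Forall 1 (Impl (Mem 1 0)
         (Exists 2 (Conj (Mem 2 0)
           (Forall 3 (Iff (Mem 3 2) (Disj (Mem 3 1) (Eq 3 1)))))))))"

definition separation_ax :: "nat \<Rightarrow> nat \<Rightarrow> nat \<Rightarrow> fm \<Rightarrow> fm" where
  "separation_ax x a b p =
     Forall a (Exists b (Forall x (Iff (Mem x b) (Conj (Mem x a) p))))"

text \<open>\<open>p\<close> has exactly one solution \<open>y\<close>; meaningful for \<open>z \<noteq> y\<close> not free in \<open>p\<close>.\<close>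

definition ExistsUnique :: "nat \<Rightarrow> nat \<Rightarrow> fm \<Rightarrow> fm" where
  "ExistsUnique z y p = Exists z (Forall y (Iff p (Eq y z)))"

definition replacement_ax :: "nat \<Rightarrow> nat \<Rightarrow> nat \<Rightarrow> nat \<Rightarrow> nat \<Rightarrow> fm \<Rightarrow> fm" where
  "replacement_ax x y z a b p =
     Forall a (Impl
       (Forall x (Impl (Mem x a) (ExistsUnique z y p)))
       (Exists b (Forall x (Impl (Mem x a) (Exists y (Conj (Mem y b) p))))))"

definition ZF :: "fm set" where
  "ZF =
     {extensionality_ax, foundation_ax, pairing_ax, union_ax, powerset_ax, infinity_ax}
     \<union> {separation_ax x a b p | x a b p. distinct [x, a, b] \<and> b \<notin> fv p}
     \<union> {replacement_ax x y z a b p | x y z a b p.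
          distinct [x, y, z, a, b] \<and> z \<notin> fv p \<and> b \<notin> fv p}"

text \<open>The values of the assignment \<open>s\<close> at the variables other than \<open>x\<close> are the parameters.\<close>

definition param_definable :: "'a eps_struct \<Rightarrow> 'a set \<Rightarrow> bool" where
  "param_definable M D \<longleftrightarrow>
     (\<exists>p x s. range s \<subseteq> carr M \<and> D = {a \<in> carr M. sat M (s(x := a)) p})"

definition submodel :: "'a eps_struct \<Rightarrow> 'a eps_struct \<Rightarrow> bool" where
  "submodel M N \<longleftrightarrow>
     carr M \<subseteq> carr N \<and> (\<forall>a\<in>carr M. \<forall>b\<in>carr M. eps M a b \<longleftrightarrow> eps N a b)"

definition end_extension :: "'a eps_struct \<Rightarrow> 'a eps_struct \<Rightarrow> bool" where
  "end_extension M N \<longleftrightarrow>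
     submodel M N \<and> (\<forall>a\<in>carr M. {x \<in> carr N. eps N x a} = {x \<in> carr M. eps M x a})"

definition proper_end_extension :: "'a eps_struct \<Rightarrow> 'a eps_struct \<Rightarrow> bool" where
  "proper_end_extension M N \<longleftrightarrow> end_extension M N \<and> carr M \<noteq> carr N"

definition conservative_extension :: "'a eps_struct \<Rightarrow> 'a eps_struct \<Rightarrow> bool" where
  "conservative_extension M N \<longleftrightarrow>
     submodel M N \<and> (\<forall>D. param_definable N D \<longrightarrow> param_definable M (D \<inter> carr M))"

end

theory Submission
  imports Defs
begin

text \<open>
  Let \<open>N\<close> be a proper conservative end extension of \<open>M\<close>. By conservativity, every subset in \<open>N\<close> of an
  element of \<open>M\<close> is in \<open>M\<close>, so the cumulative hierarchy of \<open>M\<close> is an initial part of that of \<open>N\<close> and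
  some level \<open>A\<close> of \<open>N\<close> contains all of \<open>M\<close>. Inside \<open>N\<close> there is a satisfaction class \<open>F\<close> over \<open>A\<close>, for
  a language whose quantifiers range over levels \<open>\<rho> u\<close>; here \<open>\<rho> u\<close> is the least level that witnesses the
  existential statement (formula with assignment) coded by \<open>u\<close>, and \<open>A\<close> if there is no witness.

  Among the levels \<open>\<rho> u\<close> with \<open>u\<close> in \<open>M\<close> that are not in \<open>M\<close> there is a least one \<open>\<gamma>\<close>: by conservativity
  \<open>M\<close> can define the comparison of these levels, so without a least one some \<open>\<omega>\<close>-sequence of codes in
  \<open>M\<close> would give \<open>N\<close> a strictly descending sequence of levels. For formulas with quantifiers bounded by \<open>\<gamma>\<close>
  the least level of a witness is some \<open>\<rho> v\<close> below \<open>\<gamma>\<close>, hence in \<open>M\<close>, and so \<open>M\<close> is elementary in \<open>\<gamma>\<close> by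
  the Tarski-Vaught test. Thus \<open>F\<close> restricted to \<open>M\<close> is a truth definition for \<open>M\<close>, and it is definable in
  \<open>M\<close> by conservativity, against Tarski's theorem.
\<close>

section \<open>Definability with parameters\<close>

lemma finite_fv: "finite (fv p)"
  by (induction p) auto

lemma sat_cong_fv: "(\<And>i. i \<in> fv p \<Longrightarrow> s i = t i) \<Longrightarrow> sat M s p \<longleftrightarrow> sat M t p"
proof (induction p arbitrary: s t)
  case (Exists x p)
  have "sat M (s(x := a)) p \<longleftrightarrow> sat M (t(x := a)) p" for a
    by (rule Exists.IH) (use Exists.prems in auto)
  then show ?case by simp
next
  case (Conj p q)
  have "sat M s p \<longleftrightarrow> sat M t p" by (rule Conj.IH(1)) (simp add: Conj.prems)
  moreover have "sat M s q \<longleftrightarrow> sat M t q" by (rule Conj.IH(2)) (simp add: Conj.prems)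
  ultimately show ?case by simp
next
  case (Neg p)
  have "sat M s p \<longleftrightarrow> sat M t p" by (rule Neg.IH) (simp add: Neg.prems)
  then show ?case by simp
qed auto

text \<open>Renaming without capture: bound variables move to fresh names. The bound on
  \<open>fv q\<close> later yields the freshness conditions of the separation and replacement
  schemes.\<close>

lemma rename_fm: "\<exists>q. fv q \<subseteq> f ` fv p \<and> (\<forall>s. sat M s q \<longleftrightarrow> sat M (\<lambda>n. s (f n)) p)"
proof (induction p arbitrary: f)
  case (Mem x y)
  show ?case by (rule exI[of _ "Mem (f x) (f y)"]) auto
next
  case (Eq x y)
  show ?case by (rule exI[of _ "Eq (f x) (f y)"]) auto
next
  case (Neg p)
  then obtain q where "fv q \<subseteq> f ` fv p" "\<forall>s. sat M s q \<longleftrightarrow> sat M (\<lambda>n. s (f n)) p"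
    by blast
  then show ?case by (intro exI[of _ "Neg q"]) auto
next
  case (Conj p1 p2)
  from Conj.IH(1)[of f] obtain q1 where
    "fv q1 \<subseteq> f ` fv p1" "\<forall>s. sat M s q1 \<longleftrightarrow> sat M (\<lambda>n. s (f n)) p1" by blast
  moreover from Conj.IH(2)[of f] obtain q2 where
    "fv q2 \<subseteq> f ` fv p2" "\<forall>s. sat M s q2 \<longleftrightarrow> sat M (\<lambda>n. s (f n)) p2" by blast
  ultimately show ?case by (intro exI[of _ "Conj q1 q2"]) auto
next
  case (Exists x p)
  obtain z where z: "z \<notin> f ` fv p"
    using finite_fv infinite_UNIV_nat by (metis ex_new_if_finite finite_imageI)
  from Exists.IH[of "f(x := z)"] obtain q where q: "fv q \<subseteq> f(x := z) ` fv p"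
    "\<And>s. sat M s q \<longleftrightarrow> sat M (\<lambda>n. s ((f(x := z)) n)) p" by blast
  have "sat M (s(z := a)) q \<longleftrightarrow> sat M ((\<lambda>n. s (f n))(x := a)) p" for s a
    unfolding q(2) by (rule sat_cong_fv) (use z in auto)
  then have "\<forall>s. sat M s (Exists z q) \<longleftrightarrow> sat M (\<lambda>n. s (f n)) (Exists x p)"
    by simp
  moreover have "fv (Exists z q) \<subseteq> f ` fv (Exists x p)"
  proof
    fix n
    assume "n \<in> fv (Exists z q)"
    then obtain m where "m \<in> fv p" "n = (f(x := z)) m" "n \<noteq> z" using q(1) by auto
    then show "n \<in> f ` fv (Exists x p)" by (cases "m = x") simp_all
  qed
  ultimately show ?case by (intro exI[of _ "Exists z q"] conjI)
qed

text \<open>An assignment \<open>s\<close> and a sequence of parameters \<open>e\<close> share the variables of a formula: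
  \<open>s\<close> gets the even ones, \<open>e\<close> the odd ones.\<close>

definition interleave :: "(nat \<Rightarrow> 'a) \<Rightarrow> (nat \<Rightarrow> 'a) \<Rightarrow> nat \<Rightarrow> 'a" where
  "interleave s e n = (if even n then s (n div 2) else e (n div 2))"

text \<open>Predicates on assignments; variables are used as de Bruijn indices, so a quantifier shifts the
  assignment.\<close>

definition definable :: "'a eps_struct \<Rightarrow> ((nat \<Rightarrow> 'a) \<Rightarrow> bool) \<Rightarrow> bool" where
  "definable M P \<longleftrightarrow> (\<exists>p e. range e \<subseteq> carr M \<and>
     (\<forall>s. range s \<subseteq> carr M \<longrightarrow> (P s \<longleftrightarrow> sat M (interleave s e) p)))"

lemma definableI:
  assumes "range e \<subseteq> carr M"
    and "\<And>s. range s \<subseteq> carr M \<Longrightarrow> P s \<longleftrightarrow> sat M (\<lambda>n. interleave s e (f n)) p"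
  shows "definable M P"
proof -
  obtain q where "\<forall>s. sat M s q \<longleftrightarrow> sat M (\<lambda>n. s (f n)) p"
    using rename_fm[of f p M] by blast
  then show ?thesis using assms unfolding definable_def by (intro exI[of _ q] exI[of _ e]) auto
qed

lemma definable_cong:
  assumes "definable M P" and "\<And>s. range s \<subseteq> carr M \<Longrightarrow> Q s \<longleftrightarrow> P s"
  shows "definable M Q"
proof -
  obtain p e where "range e \<subseteq> carr M"
      "\<And>s. range s \<subseteq> carr M \<Longrightarrow> P s \<longleftrightarrow> sat M (interleave s e) p"
    using assms(1) unfolding definable_def by blast
  then show ?thesis
    unfolding definable_def using assms(2) by (intro exI[of _ p] exI[of _ e]) simp
qed

lemma definable_sat:
  assumes "carr M \<noteq> {}"
  shows "definable M (\<lambda>s. sat M s p)"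
proof -
  obtain c where "c \<in> carr M" using assms by blast
  then show ?thesis
    by (intro definableI[of "\<lambda>_. c" _ _ "\<lambda>n. 2 * n" p]) (auto simp: interleave_def)
qed

lemma definable_not:
  assumes "definable M P"
  shows "definable M (\<lambda>s. \<not> P s)"
proof -
  obtain p e where "range e \<subseteq> carr M"
      "\<And>s. range s \<subseteq> carr M \<Longrightarrow> P s \<longleftrightarrow> sat M (interleave s e) p"
    using assms unfolding definable_def by blast
  then show ?thesis
    unfolding definable_def by (intro exI[of _ "Neg p"] exI[of _ e]) simp
qed

lemma definable_conj:
  assumes "definable M P" "definable M Q"
  shows "definable M (\<lambda>s. P s \<and> Q s)"
proof -
  obtain p e where p: "range e \<subseteq> carr M"
      "\<And>s. range s \<subseteq> carr M \<Longrightarrow> P s \<longleftrightarrow> sat M (interleave s e) p"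
    using assms(1) unfolding definable_def by blast
  obtain q e' where q: "range e' \<subseteq> carr M"
      "\<And>s. range s \<subseteq> carr M \<Longrightarrow> Q s \<longleftrightarrow> sat M (interleave s e') q"
    using assms(2) unfolding definable_def by blast
  \<comment> \<open>The two parameter sequences are merged: parameter \<open>m\<close> of formula
    number \<open>k\<close> becomes parameter \<open>2 * m + k\<close> of the conjunction.\<close>
  define f :: "nat \<Rightarrow> nat \<Rightarrow> nat" where
    "f k n = (if even n then n else Suc (2 * (2 * (n div 2) + k)))" for k n
  obtain p' where p': "\<forall>s. sat M s p' \<longleftrightarrow> sat M (\<lambda>n. s (f 0 n)) p"
    using rename_fm[of "f 0" p M] by blast
  obtain q' where q': "\<forall>s. sat M s q' \<longleftrightarrow> sat M (\<lambda>n. s (f 1 n)) q"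
    using rename_fm[of "f 1" q M] by blast
  have "interleave s (interleave e e') (f 0 n) = interleave s e n"
    "interleave s (interleave e e') (f 1 n) = interleave s e' n" for s n
    by (cases "even n"; simp add: interleave_def f_def del: odd_two_times_div_two_nat)+
  moreover have "range (interleave e e') \<subseteq> carr M"
    using p(1) q(1) by (auto simp: interleave_def)
  ultimately show ?thesis
    unfolding definable_def using p q p' q'
    by (intro exI[of _ "Conj p' q'"] exI[of _ "interleave e e'"]) simp
qed

lemma definable_ex:
  assumes "definable M (\<lambda>s. P (\<lambda>n. s (Suc n)) (s 0))"
  shows "definable M (\<lambda>s. \<exists>a\<in>carr M. P s a)"
proof -
  obtain p e where p: "range e \<subseteq> carr M"
      "\<And>s. range s \<subseteq> carr M \<Longrightarrow> P (\<lambda>n. s (Suc n)) (s 0) \<longleftrightarrow> sat M (interleave s e) p"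
    using assms unfolding definable_def by blast
  \<comment> \<open>The even variables, those of the assignment, move down by one place. At
    \<open>n = 0\<close> the truncated subtraction gives 0 again, but the update at 0 overrides that
    value.\<close>
  define f :: "nat \<Rightarrow> nat" where "f n = (if even n then n - 2 else n)" for n
  have "interleave (case_nat a s) e = (\<lambda>n. interleave s e (f n))(0 := a)" for a s
  proof
    fix n
    show "interleave (case_nat a s) e n = ((\<lambda>n. interleave s e (f n))(0 := a)) n"
    proof (cases "even n")
      case True
      then obtain k where "n = 2 * k" by blast
      then show ?thesis by (cases k) (simp_all add: interleave_def f_def)
    next
      case False
      then show ?thesis by (auto simp: interleave_def f_def)
    qed
  qed
  moreover have "P s a \<longleftrightarrow> sat M (interleave (case_nat a s) e) p"
    if "range s \<subseteq> carr M" "a \<in> carr M" for a s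
  proof -
    have "range (case_nat a s) \<subseteq> carr M" using that by (auto simp: subset_eq split: nat.splits)
    from p(2)[OF this] show ?thesis by simp
  qed
  ultimately show ?thesis
    using p(1) by (intro definableI[of e _ _ f "Exists 0 p"]) auto
qed

lemma definable_const:
  assumes "carr M \<noteq> {}"
  shows "definable M (\<lambda>s. b)"
proof -
  have "definable M (\<lambda>s. sat M s (if b then Eq 0 0 else Neg (Eq 0 0)))"
    by (rule definable_sat[OF assms])
  then show ?thesis by (cases b) simp_all
qed

lemma definable_disj:
  assumes "definable M P" "definable M Q"
  shows "definable M (\<lambda>s. P s \<or> Q s)"
  by (rule definable_cong[OF definable_not[OF definable_conj[OF assms[THEN definable_not]]]]) simp

lemma definable_imp:
  assumes "definable M P" "definable M Q"
  shows "definable M (\<lambda>s. P s \<longrightarrow> Q s)"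
  by (rule definable_cong[OF definable_disj[OF definable_not[OF assms(1)] assms(2)]]) simp

lemma definable_iff:
  assumes "definable M P" "definable M Q"
  shows "definable M (\<lambda>s. P s = Q s)"
  by (rule definable_cong[OF definable_conj[OF definable_imp[OF assms] definable_imp[OF assms(2,1)]]])
    blast

lemma definable_all:
  assumes "definable M (\<lambda>s. P (\<lambda>n. s (Suc n)) (s 0))"
  shows "definable M (\<lambda>s. \<forall>a\<in>carr M. P s a)"
proof -
  have "definable M (\<lambda>s. \<exists>a\<in>carr M. \<not> P s a)"
    by (intro definable_ex definable_not assms)
  from definable_not[OF this] show ?thesis by simp
qed

section \<open>Definable terms and substitution\<close>

definition dterm :: "'a eps_struct \<Rightarrow> ((nat \<Rightarrow> 'a) \<Rightarrow> 'a) \<Rightarrow> bool" where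
  "dterm M t \<longleftrightarrow> (\<forall>s. range s \<subseteq> carr M \<longrightarrow> t s \<in> carr M) \<and>
     definable M (\<lambda>s. s 0 = t (\<lambda>n. s (Suc n)))"

lemma dterm_var: "carr M \<noteq> {} \<Longrightarrow> dterm M (\<lambda>s. s i)"
  unfolding dterm_def using definable_sat[of M "Eq 0 (Suc i)"] by auto

lemma dterm_const:
  assumes "c \<in> carr M"
  shows "dterm M (\<lambda>s. c)"
proof -
  have "definable M (\<lambda>s. s 0 = c)"
    using assms by (intro definableI[of "\<lambda>_. c" _ _ id "Eq 0 1"]) (auto simp: interleave_def)
  then show ?thesis using assms by (simp add: dterm_def)
qed

lemma definable_rename:
  assumes "definable M P"
  shows "definable M (\<lambda>s. P (\<lambda>n. s (f n)))"
proof -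
  obtain p e where p: "range e \<subseteq> carr M"
      "\<And>s. range s \<subseteq> carr M \<Longrightarrow> P s \<longleftrightarrow> sat M (interleave s e) p"
    using assms unfolding definable_def by blast
  have "interleave (\<lambda>n. s (f n)) e = (\<lambda>n. interleave s e (if even n then 2 * f (n div 2) else n))" for s
    by (auto simp: interleave_def)
  moreover have "range (\<lambda>n. s (f n)) \<subseteq> carr M" if "range s \<subseteq> carr M" for s
    using that by auto
  ultimately show ?thesis
    using p by (intro definableI[of e _ _ "\<lambda>n. if even n then 2 * f (n div 2) else n" p]) auto
qed

lemma dterm_rename: 
  assumes "dterm M t"
  shows "dterm M (\<lambda>s. t (\<lambda>n. s (f n)))"
proof -
  have "definable M (\<lambda>s. s 0 = t (\<lambda>n. s (Suc n)))" using assms by (simp add: dterm_def)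
  from definable_rename[OF this, of "case_nat 0 (\<lambda>n. Suc (f n))"]
  show ?thesis using assms by (auto simp: dterm_def subset_eq)
qed

text \<open>A term is eliminated through its graph: \<open>P s (t s)\<close> says that some
  \<open>a\<close> equals \<open>t s\<close> and satisfies \<open>P s a\<close>. The later rules for
  terms inside predicates derive from this.\<close>

lemma definable_subst:
  assumes "definable M (\<lambda>s. P (\<lambda>n. s (Suc n)) (s 0))" and "dterm M t"
  shows "definable M (\<lambda>s. P s (t s))"
proof -
  have "definable M (\<lambda>s. \<exists>a\<in>carr M. a = t s \<and> P s a)"
    using assms by (intro definable_ex definable_conj) (auto simp: dterm_def)
  then show ?thesis
    by (rule definable_cong) (use assms(2) in \<open>auto simp: dterm_def\<close>)
qed

lemma definable_eq:
  assumes "dterm M t" "dterm M u"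
  shows "definable M (\<lambda>s. t s = u s)"
proof (rule definable_subst[OF _ assms(1)])
  show "definable M (\<lambda>s. s 0 = u (\<lambda>n. s (Suc n)))" using assms(2) by (simp add: dterm_def)
qed

definition els :: "'a eps_struct \<Rightarrow> 'a \<Rightarrow> 'a set" where
  "els M b = {x \<in> carr M. eps M x b}"

lemma definable_mem:
  assumes "dterm M t" "dterm M u" "carr M \<noteq> {}"
  shows "definable M (\<lambda>s. t s \<in> els M (u s))"
proof (rule definable_subst[OF _ assms(1)], rule definable_subst[OF _ dterm_rename[OF assms(2)]])
  show "definable M (\<lambda>s. s (Suc 0) \<in> els M (s 0))"
    by (rule definable_cong[OF definable_sat[OF assms(3), of "Mem 1 0"]]) (auto simp: els_def)
qed

lemma definable_1:
  assumes "definable M (\<lambda>s. P (s 0))" "dterm M t"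
  shows "definable M (\<lambda>s. P (t s))"
  by (rule definable_subst[OF _ assms(2)]) (rule assms(1))

lemma definable_2:
  assumes "definable M (\<lambda>s. P (s 0) (s 1))" "dterm M t" "dterm M u"
  shows "definable M (\<lambda>s. P (t s) (u s))"
proof (rule definable_subst[OF _ assms(2)], rule definable_subst[OF _ dterm_rename[OF assms(3)]])
  show "definable M (\<lambda>s. P (s (Suc 0)) (s 0))"
    using definable_rename[OF assms(1), of "\<lambda>n. if n = 0 then Suc 0 else 0"] by simp
qed

section \<open>Sets and classes of a model of ZF\<close>

text \<open>Closure rules, one for each construct, so that \<open>intro defn\<close> derives
  definability by following the syntax of a predicate.\<close>

named_theorems defn

lemmas [defn] = definable_not definable_conj definable_disj definable_imp definable_iff
  definable_ex definable_all definable_eq dterm_const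

lemma definable_3:
  assumes "definable M (\<lambda>s. P (s 0) (s 1) (s 2))" "dterm M t" "dterm M u" "dterm M v"
  shows "definable M (\<lambda>s. P (t s) (u s) (v s))"
proof (rule definable_subst[OF _ assms(2)], rule definable_subst[OF _ dterm_rename[OF assms(3)]],
    rule definable_subst[OF _ dterm_rename[OF dterm_rename[OF assms(4)]]])
  show "definable M (\<lambda>s. P (s (Suc (Suc 0))) (s (Suc 0)) (s 0))"
    using definable_rename[OF assms(1), of "\<lambda>n. 2 - n"] by (simp add: numeral_2_eq_2)
qed

definition dclass :: "'a eps_struct \<Rightarrow> ((nat \<Rightarrow> 'a) \<Rightarrow> 'a set) \<Rightarrow> bool" where
  "dclass M X \<longleftrightarrow> (\<forall>s. X s \<subseteq> carr M) \<and> definable M (\<lambda>s. s 0 \<in> X (\<lambda>n. s (Suc n)))"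

lemma dclass_subset: "dclass M (\<lambda>s. X) \<Longrightarrow> X \<subseteq> carr M"
  by (simp add: dclass_def)

lemma dclass_rename:
  assumes "dclass M X"
  shows "dclass M (\<lambda>s. X (\<lambda>n. s (f n)))"
proof -
  have "definable M (\<lambda>s. s 0 \<in> X (\<lambda>n. s (Suc n)))" using assms by (simp add: dclass_def)
  from definable_rename[OF this, of "case_nat 0 (\<lambda>n. Suc (f n))"]
  show ?thesis using assms by (simp add: dclass_def)
qed

lemma definable_in [defn]:
  assumes "dterm M t" "dclass M X"
  shows "definable M (\<lambda>s. t s \<in> X s)"
  by (rule definable_subst[OF _ assms(1)]) (use assms(2) in \<open>simp add: dclass_def\<close>)

lemma definable_bex [defn]:
  assumes "dclass M X" "definable M (\<lambda>s. P (\<lambda>n. s (Suc n)) (s 0))"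
  shows "definable M (\<lambda>s. \<exists>a\<in>X s. P s a)"
proof -
  have "definable M (\<lambda>s. \<exists>a\<in>carr M. a \<in> X s \<and> P s a)"
    using assms by (intro definable_ex definable_conj) (simp_all add: dclass_def)
  then show ?thesis by (rule definable_cong) (use assms(1) in \<open>auto simp: dclass_def\<close>)
qed

lemma definable_ball [defn]:
  assumes "dclass M X" "definable M (\<lambda>s. P (\<lambda>n. s (Suc n)) (s 0))"
  shows "definable M (\<lambda>s. \<forall>a\<in>X s. P s a)"
proof -
  have "definable M (\<lambda>s. \<exists>a\<in>X s. \<not> P s a)"
    by (intro definable_bex definable_not assms)
  from definable_not[OF this] show ?thesis by simp
qed

lemma definable_subset [defn]:
  assumes "dclass M X" "dclass M Y"
  shows "definable M (\<lambda>s. X s \<subseteq> Y s)"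
proof -
  have "definable M (\<lambda>s. \<forall>a\<in>X s. a \<in> Y s)"
    using assms by (intro definable_ball) (simp_all add: dclass_def)
  then show ?thesis by (rule definable_cong) auto
qed

lemma definable_set_eq [defn]:
  assumes "dclass M X" "dclass M Y"
  shows "definable M (\<lambda>s. X s = Y s)"
  by (rule definable_cong[OF definable_conj[OF definable_subset definable_subset, OF assms assms(2,1)]])
    auto

lemma dclass_carr:
  assumes "carr M \<noteq> {}"
  shows "dclass M (\<lambda>s. carr M)"
proof -
  have "definable M (\<lambda>s. s 0 \<in> carr M)"
    by (rule definable_cong[OF definable_const[OF assms, of True]]) auto
  then show ?thesis by (simp add: dclass_def)
qed

lemma dclass_Collect [defn]:
  assumes "definable M (\<lambda>s. P (\<lambda>n. s (Suc n)) (s 0))"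
  shows "dclass M (\<lambda>s. {a \<in> carr M. P s a})"
proof -
  have "definable M (\<lambda>s. s 0 \<in> {a \<in> carr M. P (\<lambda>n. s (Suc n)) a})"
    by (rule definable_cong[OF assms]) auto
  then show ?thesis by (auto simp: dclass_def)
qed

lemma dclass_Int [defn]: "dclass M X \<Longrightarrow> dclass M Y \<Longrightarrow> dclass M (\<lambda>s. X s \<inter> Y s)"
  unfolding dclass_def by (auto intro: definable_conj)

lemma dclass_Diff [defn]: "dclass M X \<Longrightarrow> dclass M Y \<Longrightarrow> dclass M (\<lambda>s. X s - Y s)"
  unfolding dclass_def by (auto intro: definable_conj definable_not)

lemma dclass_sep [defn]:
  assumes "dclass M X" "definable M (\<lambda>s. P (\<lambda>n. s (Suc n)) (s 0))"
  shows "dclass M (\<lambda>s. {a \<in> X s. P s a})"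
  using assms unfolding dclass_def by (auto intro: definable_conj)

lemma dclass_UN [defn]:
  assumes "dclass M X" "dclass M (\<lambda>s. Y (\<lambda>n. s (Suc n)) (s 0))"
  shows "dclass M (\<lambda>s. \<Union>a\<in>X s. Y s a)"
proof -
  have "definable M (\<lambda>s. s 0 \<in> Y (\<lambda>n. s (Suc (Suc n))) (s (Suc 0)))"
    using assms(2) by (simp add: dclass_def)
  \<comment> \<open>The renaming exchanges the variables 0 and 1.\<close>
  from definable_rename[OF this, of "\<lambda>n. if n = 0 then 1 else if n = 1 then 0 else n"]
  have Y: "definable M (\<lambda>s. s (Suc 0) \<in> Y (\<lambda>n. s (Suc (Suc n))) (s 0))" by simp
  have "definable M (\<lambda>s. \<exists>a\<in>X (\<lambda>n. s (Suc n)). s 0 \<in> Y (\<lambda>n. s (Suc n)) a)"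
    by (rule definable_bex[OF dclass_rename[OF assms(1)]]) (rule Y)
  moreover have "Y s a \<subseteq> carr M" for s a
    using assms(2)[unfolded dclass_def, THEN conjunct1, rule_format, of "case_nat a s"] by simp
  ultimately show ?thesis unfolding dclass_def by auto
qed

section \<open>Coded sets and the axioms in terms of them\<close>

definition is_set :: "'a eps_struct \<Rightarrow> 'a set \<Rightarrow> bool" where
  "is_set M X \<longleftrightarrow> (\<exists>b\<in>carr M. els M b = X)"

text \<open>The inverse of \<open>els\<close> on coded sets. Elsewhere the value is unspecified, so
  \<open>cd_in\<close> and \<open>els_cd\<close> ask for \<open>is_set\<close>.\<close>

definition cd :: "'a eps_struct \<Rightarrow> 'a set \<Rightarrow> 'a" where
  "cd M X = (THE b. b \<in> carr M \<and> els M b = X)"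

definition pr :: "'a eps_struct \<Rightarrow> 'a \<Rightarrow> 'a \<Rightarrow> 'a" where
  "pr M a b = cd M {cd M {a}, cd M {a, b}}"

lemma sat_connectives:
  "sat M s (Forall x p) \<longleftrightarrow> (\<forall>a\<in>carr M. sat M (s(x := a)) p)"
  "sat M s (Iff p q) \<longleftrightarrow> (sat M s p \<longleftrightarrow> sat M s q)"
  "sat M s (Impl p q) \<longleftrightarrow> (sat M s p \<longrightarrow> sat M s q)"
  "sat M s (Disj p q) \<longleftrightarrow> (sat M s p \<or> sat M s q)"
  by auto

lemma els_subset: "els M b \<subseteq> carr M"
  by (auto simp: els_def)

locale zf =
  fixes M :: "'a eps_struct"
  assumes zf: "models M ZF"
begin

abbreviation "C \<equiv> carr M"
abbreviation "el \<equiv> els M"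

lemma carr_ne: "C \<noteq> {}"
  using zf by (simp add: models_def)

lemma sat_ax: "p \<in> ZF \<Longrightarrow> range s \<subseteq> C \<Longrightarrow> sat M s p"
  using zf by (simp add: models_def)

lemma dterm_var' [defn]: "dterm M (\<lambda>s. s i)"
  by (rule dterm_var[OF carr_ne])

lemma definable_const' [defn]: "definable M (\<lambda>s. b)"
  by (rule definable_const[OF carr_ne])

lemma dclass_carr' [defn]: "dclass M (\<lambda>s. C)"
  by (rule dclass_carr[OF carr_ne])

lemma dclass_els [defn]:
  assumes "dterm M t"
  shows "dclass M (\<lambda>s. el (t s))"
proof -
  have "definable M (\<lambda>s. s 0 \<in> el (t (\<lambda>n. s (Suc n))))"
    by (rule definable_mem[OF dterm_var' dterm_rename[OF assms] carr_ne])
  then show ?thesis by (simp add: dclass_def els_subset)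
qed

lemma dclass_empty [defn]: "dclass M (\<lambda>s. {})"
  by (simp add: dclass_def definable_const')

lemma extensional:
  assumes "a \<in> C" "b \<in> C" "el a = el b"
  shows "a = b"
proof -
  have "sat M (\<lambda>_. a) extensionality_ax"
    by (rule sat_ax) (use assms(1) in \<open>auto simp: ZF_def\<close>)
  then have "\<forall>x\<in>C. \<forall>y\<in>C. (\<forall>z\<in>C. eps M z x \<longleftrightarrow> eps M z y) \<longrightarrow> x = y"
    unfolding extensionality_ax_def by (simp only: sat_connectives sat.simps(1,2,5)) simp
  then show ?thesis using assms by (auto simp: els_def)
qed

lemma cd_els: "b \<in> C \<Longrightarrow> cd M (el b) = b"
  unfolding cd_def by (rule the_equality) (auto intro: extensional)

lemma cd_in: "is_set M X \<Longrightarrow> cd M X \<in> C"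
  unfolding is_set_def using cd_els by auto

lemma els_cd: "is_set M X \<Longrightarrow> el (cd M X) = X"
  unfolding is_set_def using cd_els by auto

lemma is_set_els: "b \<in> C \<Longrightarrow> is_set M (el b)"
  by (auto simp: is_set_def)

lemma is_set_subset: "is_set M X \<Longrightarrow> X \<subseteq> C"
  by (auto simp: is_set_def els_def)

lemma is_set_sep:
  assumes "is_set M Y" "X \<subseteq> Y" "dclass M (\<lambda>s. X)"
  shows "is_set M X"
proof -
  obtain a where a: "a \<in> C" "el a = Y" using assms(1) by (auto simp: is_set_def)
  have "definable M (\<lambda>s. s 0 \<in> X)" using assms(3) by (simp add: dclass_def)
  then obtain p e where e: "range e \<subseteq> C"
      and p: "\<And>s. range s \<subseteq> C \<Longrightarrow> s 0 \<in> X \<longleftrightarrow> sat M (interleave s e) p"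
    unfolding definable_def by blast
  \<comment> \<open>Variable 0 remains the tested element; all others move past 1 and 2, the names
    of the two sets in the axiom.\<close>
  define f :: "nat \<Rightarrow> nat" where "f n = (if n = 0 then 0 else n + 2)" for n
  obtain q where q: "fv q \<subseteq> f ` fv p" "\<forall>s. sat M s q \<longleftrightarrow> sat M (\<lambda>n. s (f n)) p"
    using rename_fm[of f p M] by blast
  define s where "s n = interleave (\<lambda>_. a) e (n - 2)" for n
  have s: "range s \<subseteq> C" using e a by (auto simp: s_def interleave_def)
  have "distinct [0, 1, 2::nat] \<and> 2 \<notin> fv q" using q(1) by (auto simp: f_def split: if_splits)
  then have "separation_ax 0 1 2 q \<in> ZF" unfolding ZF_def by blast
  from sat_ax[OF this s] obtain b where b: "b \<in> C"
    "\<And>x. x \<in> C \<Longrightarrow> eps M x b \<longleftrightarrow> eps M x a \<and> sat M (s(1 := a, 2 := b, 0 := x)) q"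
    unfolding separation_ax_def using a(1)
    by (simp only: sat_connectives sat.simps(1,2,5)) (auto simp: fun_upd_twist)
  have "sat M (s(1 := a, 2 := b, 0 := x)) q \<longleftrightarrow> x \<in> X" if x: "x \<in> C" for x
  proof -
    have "(\<lambda>n. (s(1 := a, 2 := b, 0 := x)) (f n)) = interleave (case_nat x (\<lambda>_. a)) e"
    proof
      fix n
      show "(s(1 := a, 2 := b, 0 := x)) (f n) = interleave (case_nat x (\<lambda>_. a)) e n"
        by (cases n) (auto simp: s_def f_def interleave_def elim!: evenE split: nat.split)
    qed
    moreover have "range (case_nat x (\<lambda>_. a)) \<subseteq> C" using x a by (auto split: nat.splits)
    ultimately show ?thesis using q(2) p[of "case_nat x (\<lambda>_. a)"] by simp
  qed
  then have "el b = X" using b(2) a assms(2) els_subset[of M a] by (auto simp: els_def)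
  then show ?thesis using b(1) by (auto simp: is_set_def)
qed

lemma replacement:
  assumes "is_set M X" "definable M (\<lambda>s. R (s 0) (s 1))"
    "\<And>x. x \<in> X \<Longrightarrow> \<exists>z\<in>C. \<forall>y\<in>C. R x y \<longleftrightarrow> y = z"
  obtains b where "b \<in> C" "\<And>x. x \<in> X \<Longrightarrow> \<exists>y\<in>el b. R x y"
proof -
  obtain a where a: "a \<in> C" "el a = X" using assms(1) by (auto simp: is_set_def)
  obtain p e where e: "range e \<subseteq> C"
      and p: "\<And>s. range s \<subseteq> C \<Longrightarrow> R (s 0) (s 1) \<longleftrightarrow> sat M (interleave s e) p"
    using assms(2) unfolding definable_def by blast
  \<comment> \<open>The arguments of \<open>R\<close> sit at the even variables 0 and 2 of
    \<open>p\<close> and become 0 and 1, the \<open>x\<close> and \<open>y\<close> of the axiom; the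
    others move beyond all names used there.\<close>
  define f :: "nat \<Rightarrow> nat" where "f n = (if n = 0 then 0 else if n = 2 then 1 else n + 10)" for n
  obtain q where q: "fv q \<subseteq> f ` fv p" "\<forall>s. sat M s q \<longleftrightarrow> sat M (\<lambda>n. s (f n)) p"
    using rename_fm[of f p M] by blast
  define s where "s n = interleave (\<lambda>_. a) e (n - 10)" for n
  have s: "range s \<subseteq> C" using e a by (auto simp: s_def interleave_def)
  have "distinct [0, 1, 2, 3, 4::nat] \<and> 2 \<notin> fv q \<and> 4 \<notin> fv q"
    using q(1) by (auto simp: f_def split: if_splits)
  then have "replacement_ax 0 1 2 3 4 q \<in> ZF" unfolding ZF_def by blast
  note ax = sat_ax[OF this s]
  \<comment> \<open>Stated for every assignment with the same parameters, because \<open>q\<close>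
    occurs twice in the axiom, under different updates.\<close>
  have R: "sat M s' q \<longleftrightarrow> R (s' 0) (s' 1)"
    if "\<And>n. n > 9 \<Longrightarrow> s' n = s n" "s' 0 \<in> C" "s' 1 \<in> C" for s'
  proof -
    have "(\<lambda>n. s' (f n)) = interleave (case_nat (s' 0) (case_nat (s' 1) (\<lambda>_. a))) e"
    proof
      fix n
      show "s' (f n) = interleave (case_nat (s' 0) (case_nat (s' 1) (\<lambda>_. a))) e n"
        using that(1)[of "n + 10"]
        by (auto simp: s_def f_def interleave_def elim!: evenE split: nat.split)
    qed
    moreover have "range (case_nat (s' 0) (case_nat (s' 1) (\<lambda>_. a))) \<subseteq> C"
      using that a by (auto split: nat.splits)
    ultimately show ?thesis using q(2) p[of "case_nat (s' 0) (case_nat (s' 1) (\<lambda>_. a))"] by simp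
  qed
  have R1: "sat M (s(3 := a, 0 := x, 2 := z, 1 := y)) q \<longleftrightarrow> R x y" if "x \<in> C" "y \<in> C" for x y z
    using that by (subst R) auto
  have R2: "sat M (s(3 := a, 4 := b, 0 := x, 1 := y)) q \<longleftrightarrow> R x y" if "x \<in> C" "y \<in> C" for x y b
    using that by (subst R) auto
  have "\<forall>x\<in>C. eps M x a \<longrightarrow> (\<exists>z\<in>C. \<forall>y\<in>C. R x y \<longleftrightarrow> y = z)"
  proof (intro ballI impI)
    fix x
    assume "x \<in> C" "eps M x a"
    then have "x \<in> X" using a(2) by (auto simp: els_def)
    then show "\<exists>z\<in>C. \<forall>y\<in>C. R x y \<longleftrightarrow> y = z" by (rule assms(3))
  qed
  then have "sat M (s(3 := a)) (Forall 0 (Impl (Mem 0 3) (ExistsUnique 2 1 q)))"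
    unfolding ExistsUnique_def
    by (simp only: sat_connectives sat.simps(1,2,5)) (simp add: R1[unfolded One_nat_def] Ball_def Bex_def)
  then have "sat M (s(3 := a)) (Exists 4 (Forall 0 (Impl (Mem 0 3) (Exists 1 (Conj (Mem 1 4) q)))))"
    using ax a(1) unfolding replacement_ax_def sat_connectives(1)[of _ _ 3] sat_connectives(3) by blast
  then obtain b where b: "b \<in> C" "\<forall>x\<in>C. eps M x a \<longrightarrow> (\<exists>y\<in>C. eps M y b \<and> R x y)"
    by (simp only: sat_connectives sat.simps(1,2,5)) (auto simp: R2[unfolded One_nat_def])
  show thesis
  proof (rule that[OF b(1)])
    fix x
    assume "x \<in> X"
    then show "\<exists>y\<in>el b. R x y" using b(2) a(2) by (auto simp: els_def)
  qed
qed

lemma foundation: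
  assumes "is_set M X" "X \<noteq> {}"
  obtains x where "x \<in> X" "el x \<inter> X = {}"
proof -
  obtain a where a: "a \<in> C" "el a = X" using assms(1) by (auto simp: is_set_def)
  have "sat M (\<lambda>_. a) foundation_ax"
    by (rule sat_ax) (use a(1) in \<open>auto simp: ZF_def\<close>)
  then have "\<forall>x\<in>C. (\<exists>y\<in>C. eps M y x) \<longrightarrow> (\<exists>y\<in>C. eps M y x \<and> \<not> (\<exists>z\<in>C. eps M z x \<and> eps M z y))"
    unfolding foundation_ax_def by (simp only: sat_connectives sat.simps(1,2,5)) simp
  moreover have "\<exists>y\<in>C. eps M y a" using a assms(2) by (auto simp: els_def)
  ultimately obtain y where "y \<in> C" "eps M y a" "\<not> (\<exists>z\<in>C. eps M z a \<and> eps M z y)"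
    using a(1) by blast
  then show thesis by (intro that[of y]) (use a in \<open>auto simp: els_def\<close>)
qed

lemma is_set_upair:
  assumes "a \<in> C" "b \<in> C"
  shows "is_set M {a, b}"
proof -
  have "sat M (\<lambda>_. a) pairing_ax"
    by (rule sat_ax) (use assms(1) in \<open>auto simp: ZF_def\<close>)
  then have "\<forall>x\<in>C. \<forall>y\<in>C. \<exists>z\<in>C. \<forall>w\<in>C. eps M w z \<longleftrightarrow> w = x \<or> w = y"
    unfolding pairing_ax_def by (simp only: sat_connectives sat.simps(1,2,5)) (simp add: disj_imp)
  then obtain z where "z \<in> C" "\<forall>w\<in>C. eps M w z \<longleftrightarrow> w = a \<or> w = b" using assms by blast
  moreover from this have "el z = {a, b}" using assms by (auto simp: els_def)
  ultimately show ?thesis by (auto simp: is_set_def)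
qed

lemma is_set_single: "a \<in> C \<Longrightarrow> is_set M {a}"
  using is_set_upair[of a a] by simp

lemma is_set_Union:
  assumes "is_set M X"
  shows "is_set M (\<Union>x\<in>X. el x)"
proof -
  obtain a where a: "a \<in> C" "el a = X" using assms(1) by (auto simp: is_set_def)
  have "sat M (\<lambda>_. a) union_ax"
    by (rule sat_ax) (use a(1) in \<open>auto simp: ZF_def\<close>)
  then have "\<forall>x\<in>C. \<exists>y\<in>C. \<forall>z\<in>C. eps M z y \<longleftrightarrow> (\<exists>w\<in>C. eps M w x \<and> eps M z w)"
    unfolding union_ax_def by (simp only: sat_connectives sat.simps(1,2,5)) simp
  then obtain y where "y \<in> C" "\<forall>z\<in>C. eps M z y \<longleftrightarrow> (\<exists>w\<in>C. eps M w a \<and> eps M z w)"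
    using a(1) by blast
  moreover from this have "el y = (\<Union>x\<in>X. el x)" using a(2) by (auto simp: els_def)
  ultimately show ?thesis by (auto simp: is_set_def)
qed

lemma is_set_Pow:
  assumes "is_set M X"
  shows "is_set M {x \<in> C. el x \<subseteq> X}"
proof -
  obtain a where a: "a \<in> C" "el a = X" using assms(1) by (auto simp: is_set_def)
  have "sat M (\<lambda>_. a) powerset_ax"
    by (rule sat_ax) (use a(1) in \<open>auto simp: ZF_def\<close>)
  then have "\<forall>x\<in>C. \<exists>y\<in>C. \<forall>z\<in>C. eps M z y \<longleftrightarrow> (\<forall>w\<in>C. eps M w z \<longrightarrow> eps M w x)"
    unfolding powerset_ax_def by (simp only: sat_connectives sat.simps(1,2,5)) simp
  then obtain y where "y \<in> C" "\<forall>z\<in>C. eps M z y \<longleftrightarrow> (\<forall>w\<in>C. eps M w z \<longrightarrow> eps M w a)"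
    using a(1) by blast
  moreover from this have "el y = {x \<in> C. el x \<subseteq> X}" using a(2) by (auto simp: els_def)
  ultimately show ?thesis by (auto simp: is_set_def)
qed

lemma is_set_Un:
  assumes "is_set M X" "is_set M Y"
  shows "is_set M (X \<union> Y)"
proof -
  have "is_set M (\<Union>x\<in>{cd M X, cd M Y}. el x)"
    by (intro is_set_Union is_set_upair cd_in assms)
  then show ?thesis using assms by (simp add: els_cd)
qed

lemma is_set_insert: "a \<in> C \<Longrightarrow> is_set M X \<Longrightarrow> is_set M (insert a X)"
  using is_set_Un[OF is_set_single, of a X] by simp

lemma dclass_is_set: 
  assumes "is_set M X"
  shows "dclass M (\<lambda>s. X)"
proof -
  obtain a where a: "a \<in> C" "el a = X" using assms by (auto simp: is_set_def)
  from dclass_els[OF dterm_const[OF a(1)]] show ?thesis by (simp add: a(2))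
qed

lemma is_set_Int: "is_set M X \<Longrightarrow> dclass M (\<lambda>s. Y) \<Longrightarrow> is_set M (X \<inter> Y)"
  by (rule is_set_sep[of X]) (simp_all add: dclass_Int dclass_is_set)

lemma is_set_empty: "is_set M {}"
proof -
  obtain a where "a \<in> C" using carr_ne by blast
  from is_set_Int[OF is_set_els[OF this] dclass_empty] show ?thesis by simp
qed

section \<open>Kuratowski pairs and products\<close>

lemma pr_in: "a \<in> C \<Longrightarrow> b \<in> C \<Longrightarrow> pr M a b \<in> C"
  unfolding pr_def by (intro cd_in is_set_upair is_set_single)

lemma els_pr:
  assumes "a \<in> C" "b \<in> C"
  shows "el (pr M a b) = {cd M {a}, cd M {a, b}}"
  unfolding pr_def using assms by (simp add: els_cd is_set_upair is_set_single cd_in)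

lemma pr_inj:
  assumes "pr M a b = pr M c d" "a \<in> C" "b \<in> C" "c \<in> C" "d \<in> C"
  shows "a = c \<and> b = d"
proof -
  have "el (pr M a b) = {cd M {a}, cd M {a, b}}" "el (pr M c d) = {cd M {c}, cd M {c, d}}"
    using assms(2-) by (simp_all add: els_pr)
  then have "{cd M {a}, cd M {a, b}} = {cd M {c}, cd M {c, d}}" using assms(1) by simp
  then have "el ` {cd M {a}, cd M {a, b}} = el ` {cd M {c}, cd M {c, d}}" by simp
  then have "{{a}, {a, b}} = {{c}, {c, d}}"
    using assms by (simp add: els_cd is_set_upair is_set_single)
  then show ?thesis by (auto simp: doubleton_eq_iff)
qed

lemma pr_eq [simp]:
  "a \<in> C \<Longrightarrow> b \<in> C \<Longrightarrow> c \<in> C \<Longrightarrow> d \<in> C \<Longrightarrow> pr M a b = pr M c d \<longleftrightarrow> a = c \<and> b = d"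
  using pr_inj by blast

text \<open>The pair is described by membership alone, with the codes of \<open>{x}\<close> and
  \<open>{x, y}\<close> as existential witnesses.\<close>

lemma dterm_pr [defn]:
  assumes "dterm M t" "dterm M u"
  shows "dterm M (\<lambda>s. pr M (t s) (u s))"
proof -
  have pr_iff: "z = pr M x y \<longleftrightarrow> (\<exists>v\<in>C. \<exists>w\<in>C. (\<forall>c\<in>C. c \<in> el v \<longleftrightarrow> c = x) \<and>
      (\<forall>c\<in>C. c \<in> el w \<longleftrightarrow> c = x \<or> c = y) \<and> (\<forall>c\<in>C. c \<in> el z \<longleftrightarrow> c = v \<or> c = w))"
    (is "_ \<longleftrightarrow> (\<exists>v\<in>C. \<exists>w\<in>C. ?P v w)")
    if "x \<in> C" "y \<in> C" "z \<in> C" for x y z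
  proof
    assume "z = pr M x y"
    then have "el z = {cd M {x}, cd M {x, y}}"
      using that by (simp add: els_pr)
    then show "\<exists>v\<in>C. \<exists>w\<in>C. ?P v w" using that
      by (intro bexI[of _ "cd M {x}"] bexI[of _ "cd M {x, y}"])
        (simp_all add: els_cd is_set_upair is_set_single cd_in)
  next
    assume "\<exists>v\<in>C. \<exists>w\<in>C. ?P v w"
    then obtain v w where vw: "v \<in> C" "w \<in> C" "?P v w" by blast
    then have "el v = {x}" "el w = {x, y}" "el z = {v, w}"
      using that els_subset[of M v] els_subset[of M w] els_subset[of M z] by auto
    then have "v = cd M {x}" "w = cd M {x, y}" "z = cd M {v, w}"
      using cd_els[OF vw(1)] cd_els[OF vw(2)] cd_els[OF that(3)] by simp_all
    then show "z = pr M x y" by (simp add: pr_def)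
  qed
  have "definable M (\<lambda>s. s 0 = pr M (s 1) (s 2))"
  proof (rule definable_cong)
    show "definable M (\<lambda>s. \<exists>v\<in>C. \<exists>w\<in>C. (\<forall>c\<in>C. c \<in> el v \<longleftrightarrow> c = s 1) \<and>
      (\<forall>c\<in>C. c \<in> el w \<longleftrightarrow> c = s 1 \<or> c = s 2) \<and> (\<forall>c\<in>C. c \<in> el (s 0) \<longleftrightarrow> c = v \<or> c = w))"
      by (intro defn)
  qed (rule pr_iff; blast)
  from definable_3[OF this dterm_var' dterm_rename[OF assms(1)] dterm_rename[OF assms(2)]]
  show ?thesis using assms by (simp add: dterm_def pr_in)
qed

definition times :: "'a set \<Rightarrow> 'a set \<Rightarrow> 'a set" where
  "times X Y = {z \<in> C. \<exists>x\<in>X. \<exists>y\<in>Y. z = pr M x y}"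

lemma is_set_times:
  assumes "is_set M X" "is_set M Y"
  shows "is_set M (times X Y)"
proof (rule is_set_sep)
  have *: "X \<subseteq> C" "Y \<subseteq> C" using assms is_set_subset by auto
  let ?P = "\<lambda>Z. {x \<in> C. el x \<subseteq> Z}"
  show "is_set M (?P (?P (X \<union> Y)))" by (intro is_set_Pow is_set_Un assms)
  show "times X Y \<subseteq> ?P (?P (X \<union> Y))"
  proof
    fix z
    assume "z \<in> times X Y"
    then obtain x y where xy: "x \<in> X" "y \<in> Y" "z = pr M x y" "z \<in> C" by (auto simp: times_def)
    then have "x \<in> C" "y \<in> C" using * by auto
    then have "el z = {cd M {x}, cd M {x, y}}" "el (cd M {x}) = {x}" "el (cd M {x, y}) = {x, y}"
       "cd M {x} \<in> C" "cd M {x, y} \<in> C"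
      unfolding xy(3) by (simp_all add: els_pr els_cd is_set_upair is_set_single cd_in)
    then show "z \<in> ?P (?P (X \<union> Y))" using xy by auto
  qed
  show "dclass M (\<lambda>s. times X Y)"
    unfolding times_def by (intro defn dclass_is_set assms)
qed

end

section \<open>Recursion inside a model\<close>

definition trans_class :: "'a eps_struct \<Rightarrow> 'a set \<Rightarrow> bool" where
  "trans_class M X \<longleftrightarrow> (\<forall>x\<in>X. els M x \<subseteq> X)"

definition sec :: "'a eps_struct \<Rightarrow> 'a \<Rightarrow> 'a \<Rightarrow> 'a set" where
  "sec M T y = {a \<in> carr M. pr M y a \<in> els M T}"

context zf
begin

lemma definable_trans_class [defn]:
  assumes "dterm M t"
  shows "definable M (\<lambda>s. trans_class M (el (t s)))"
proof -
  have "definable M (\<lambda>s. trans_class M (el (s 0)))" unfolding trans_class_def by (intro defn)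
  from definable_1[OF this assms] show ?thesis .
qed

lemma dclass_sec [defn]:
  assumes "dterm M t" "dterm M u"
  shows "dclass M (\<lambda>s. sec M (t s) (u s))"
proof -
  have "definable M (\<lambda>s. pr M (u (\<lambda>n. s (Suc n))) (s 0) \<in> el (t (\<lambda>n. s (Suc n))))"
    by (intro defn dterm_rename[OF assms(1), of Suc] dterm_rename[OF assms(2), of Suc])
  then show ?thesis unfolding sec_def by (rule dclass_Collect)
qed

lemma els_in_carr: "x \<in> el b \<Longrightarrow> x \<in> C"
  by (simp add: els_def)

lemma sec_subset: "sec M T y \<subseteq> C"
  by (auto simp: sec_def)

text \<open>If the pair of \<open>y\<close> and \<open>a\<close> is in \<open>T\<close>, then
  \<open>a\<close> is an element of an element of that pair, so two unions suffice. The bound is the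
  same for all \<open>y\<close>, and sections become sets by separation.\<close>

lemma sec_bounded:
  assumes "y \<in> C"
  shows "sec M T y \<subseteq> (\<Union>x\<in>(\<Union>x\<in>el T. el x). el x)"
proof
  fix a
  assume "a \<in> sec M T y"
  then have "a \<in> C" "pr M y a \<in> el T" by (auto simp: sec_def)
  moreover from this assms have "cd M {y, a} \<in> el (pr M y a)" "a \<in> el (cd M {y, a})"
    by (simp_all add: els_pr els_cd is_set_upair)
  ultimately show "a \<in> (\<Union>x\<in>(\<Union>x\<in>el T. el x). el x)" by blast
qed

lemma pr_in_times:
  "x \<in> C \<Longrightarrow> a \<in> C \<Longrightarrow> X \<subseteq> C \<Longrightarrow> Y \<subseteq> C \<Longrightarrow> pr M x a \<in> times X Y \<longleftrightarrow> x \<in> X \<and> a \<in> Y"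
  unfolding times_def by (auto simp: pr_in subset_eq)

lemma is_set_sec_bound: "T \<in> C \<Longrightarrow> is_set M (\<Union>x\<in>(\<Union>x\<in>el T. el x). el x)"
  by (intro is_set_Union is_set_els)

text \<open>\<open>W\<close> replaces the transitive closure of \<open>x\<close>, whose existence is only derived from recursion.\<close>

lemma strong_foundation:
  assumes U: "is_set M U" "trans_class M U" and B: "B \<subseteq> U" "B \<noteq> {}" "dclass M (\<lambda>s. B)"
  obtains x W where "x \<in> B" "is_set M W" "trans_class M W" "W \<subseteq> U" "el x \<subseteq> W" "W \<inter> B = {}"
proof -
  \<comment> \<open>\<open>W\<close> is the largest transitive set within \<open>U\<close> that
    avoids \<open>B\<close>; an \<in>-minimal element \<open>x\<close> of \<open>U - W\<close> has
    all its elements in \<open>W\<close>.\<close>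
  define P where "P = {w \<in> C. el w \<subseteq> U \<and> trans_class M (el w) \<and> el w \<inter> B = {}}"
  define W where "W = (\<Union>w\<in>P. el w)"
  have dW: "dclass M (\<lambda>s. W)"
    unfolding W_def P_def by (intro defn dclass_is_set[OF U(1)] B(3))
  have W: "W \<subseteq> U" "W \<inter> B = {}" by (auto simp: W_def P_def)
  have WP: "\<forall>w\<in>P. el w \<subseteq> W" by (auto simp: W_def)
  have Wtr: "trans_class M W" by (auto simp: W_def P_def trans_class_def)
  have "is_set M W" by (rule is_set_sep[OF U(1) W(1) dW])
  have "is_set M (U - W)"
    by (rule is_set_sep[OF U(1)]) (auto intro!: dclass_Diff dW dclass_is_set[OF U(1)])
  moreover have "U - W \<noteq> {}" using B W by blast
  ultimately obtain x where x: "x \<in> U - W" "el x \<inter> (U - W) = {}" by (rule foundation)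
  have "el x \<subseteq> U" using U(2) x(1) by (auto simp: trans_class_def)
  then have xW: "el x \<subseteq> W" using x(2) by blast
  \<comment> \<open>Otherwise \<open>insert x W\<close> would be one of the sets united in
    \<open>W\<close>.\<close>
  have "x \<in> B"
  proof (rule ccontr)
    assume "x \<notin> B"
    have "x \<in> C" using x(1) is_set_subset[OF U(1)] by blast
    have s: "is_set M (insert x W)" by (rule is_set_insert[OF \<open>x \<in> C\<close> \<open>is_set M W\<close>])
    have "trans_class M (insert x W)" using Wtr xW by (auto simp: trans_class_def)
    then have "cd M (insert x W) \<in> P"
      using s W x \<open>x \<notin> B\<close> by (simp add: P_def els_cd cd_in)
    then have "el (cd M (insert x W)) \<subseteq> W" using WP by blast
    then have "x \<in> W" by (simp add: els_cd[OF s])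
    then show False using x(1) by blast
  qed
  then show thesis using \<open>is_set M W\<close> Wtr W(1) xW W(2) by (rule that)
qed

text \<open>A function with class values is coded as a set \<open>T\<close> of pairs, with the section at \<open>x\<close> as the value
  at \<open>x\<close>. The value at \<open>x\<close> may depend on the values on the transitive closure of \<open>x\<close>, not just on the
  elements of \<open>x\<close>, because the subformulas of a code lie inside nested pairs.\<close>

lemma recursion:
  assumes t: "t \<in> C" "trans_class M (el t)"
    and local: "\<And>x u f g. is_set M u \<Longrightarrow> trans_class M u \<Longrightarrow> x \<in> C \<Longrightarrow> el x \<subseteq> u \<Longrightarrow>
      (\<forall>y\<in>u. f y = g y) \<Longrightarrow> \<Phi> x f = \<Phi> x g"
    and set: "\<And>x T. x \<in> el t \<Longrightarrow> T \<in> C \<Longrightarrow> is_set M (\<Phi> x (sec M T))"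
    and sub: "\<And>x f. \<Phi> x f \<subseteq> C"
    and def: "definable M (\<lambda>s. s 0 \<in> \<Phi> (s 1) (sec M (s 2)))"
  obtains T where "T \<in> C" "\<And>x. x \<in> el t \<Longrightarrow> sec M T x = \<Phi> x (sec M T)"
proof -
  have tC: "el t \<subseteq> C" by (rule els_subset)
  have dPhi: "dclass M (\<lambda>s. \<Phi> (a s) (sec M (b s)))" if "dterm M a" "dterm M b" for a b
    unfolding dclass_def
    using definable_3[OF def dterm_var' dterm_rename[OF that(1)] dterm_rename[OF that(2)]] sub
    by simp
  \<comment> \<open>\<open>good T u\<close> makes \<open>T\<close> an attempt at the recursion that
    is correct on the transitive set \<open>u\<close>; \<open>G x T\<close> says that the attempt
    reaches \<open>x\<close>, and \<open>V x y\<close> that \<open>y\<close> codes the value at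
    \<open>x\<close>.\<close>
  define good where "good T u \<longleftrightarrow> trans_class M (el u) \<and> el u \<subseteq> el t \<and>
    (\<forall>x\<in>el u. sec M T x = \<Phi> x (sec M T))" for T u
  define G where "G x T \<longleftrightarrow> (\<exists>u\<in>C. good T u \<and> x \<in> el u)" for x T
  define V where "V x y \<longleftrightarrow> (\<exists>T\<in>C. G x T \<and> el y = sec M T x)" for x y
  have "definable M (\<lambda>s. G (s 0) (s 1))"
    unfolding G_def good_def by (intro defn dPhi t(1))
  note dG = definable_2[OF this]
  have "definable M (\<lambda>s. V (s 0) (s 1))"
    unfolding V_def by (intro defn dG)
  note dV = definable_2[OF this]
  \<comment> \<open>At a minimal place \<open>y\<close> of disagreement both attempts agree on a
    transitive set \<open>W\<close> around the elements of \<open>y\<close>, so \<open>local\<close>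
    forces equal values there.\<close>
  have agree: "sec M T x = sec M T' x" if GT: "G x T" "G x T'" "T \<in> C" "T' \<in> C" for x T T'
  proof (rule ccontr)
    assume neq: "sec M T x \<noteq> sec M T' x"
    obtain u u' where u: "u \<in> C" "u' \<in> C" "good T u" "good T' u'" "x \<in> el u" "x \<in> el u'"
      using GT by (auto simp: G_def)
    define B where "B = {y \<in> el u \<inter> el u'. sec M T y \<noteq> sec M T' y}"
    have *: "is_set M (el u \<inter> el u')"
      using u by (intro is_set_Int is_set_els defn)
    have **: "trans_class M (el u \<inter> el u')" using u by (auto simp: trans_class_def good_def)
    have "dclass M (\<lambda>s. B)" unfolding B_def using u GT by (intro defn)
    moreover have "B \<noteq> {}" using neq u by (auto simp: B_def)
    moreover have "B \<subseteq> el u \<inter> el u'" by (auto simp: B_def)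
    ultimately obtain y W where y: "y \<in> B" and W: "is_set M W" "trans_class M W" "W \<subseteq> el u \<inter> el u'"
        "el y \<subseteq> W" "W \<inter> B = {}"
      using strong_foundation[OF * **] by metis
    have yC: "y \<in> C" using y tC u by (auto simp: B_def good_def)
    have "\<forall>z\<in>W. sec M T z = sec M T' z" using W(3,5) by (auto simp: B_def)
    then have "\<Phi> y (sec M T) = \<Phi> y (sec M T')" by (rule local[OF W(1,2) yC W(4)])
    moreover have "sec M T y = \<Phi> y (sec M T)" "sec M T' y = \<Phi> y (sec M T')"
      using y u by (auto simp: B_def good_def)
    ultimately show False using y by (auto simp: B_def)
  qed
  define D where "D = {x \<in> el t. \<exists>T\<in>C. G x T}"
  have DC: "D \<subseteq> C" using tC by (auto simp: D_def)
  have sD: "is_set M D"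
    by (rule is_set_sep[OF is_set_els[OF t(1)]]) (unfold D_def, blast, intro defn dG t(1))
  have Gtr: "G y T" if "G x T" "y \<in> el x" for x y T
    using that by (auto simp: G_def good_def trans_class_def)
  have Dtr: "trans_class M D"
    unfolding trans_class_def
  proof (intro ballI subsetI)
    fix x y
    assume "x \<in> D" "y \<in> el x"
    then obtain T where "T \<in> C" "G x T" "x \<in> el t" by (auto simp: D_def)
    then show "y \<in> D" using Gtr[of x T y] t(2) \<open>y \<in> el x\<close> by (auto simp: D_def trans_class_def)
  qed
  \<comment> \<open>Replacement collects the values of all attempts, which depend only on
    \<open>x\<close> by \<open>agree\<close>; they are then glued into a single attempt
    \<open>T0\<close> on \<open>D\<close>.\<close>
  obtain b where b: "b \<in> C" "\<And>x. x \<in> D \<Longrightarrow> \<exists>y\<in>el b. V x y"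
  proof (rule replacement[OF sD, of V])
    show "definable M (\<lambda>s. V (s 0) (s 1))" by (intro defn dV)
    fix x
    assume "x \<in> D"
    then obtain T where T: "T \<in> C" "G x T" "x \<in> el t" by (auto simp: D_def)
    have "x \<in> C" using \<open>x \<in> D\<close> DC by blast
    have s: "is_set M (sec M T x)"
      by (rule is_set_sep[OF is_set_sec_bound[OF T(1)] sec_bounded[OF \<open>x \<in> C\<close>]])
        (intro defn T \<open>x \<in> C\<close>)
    show "\<exists>z\<in>C. \<forall>y\<in>C. V x y \<longleftrightarrow> y = z"
    proof (intro bexI ballI iffI)
      show "cd M (sec M T x) \<in> C" by (rule cd_in[OF s])
      fix y
      assume "y \<in> C"
      {
        assume "V x y"
        then obtain T' where "T' \<in> C" "G x T'" "el y = sec M T' x" by (auto simp: V_def)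
        then have "el y = sec M T x" using agree T by metis
        then show "y = cd M (sec M T x)" using cd_els[OF \<open>y \<in> C\<close>] by simp
      }
      assume "y = cd M (sec M T x)"
      then show "V x y" using T els_cd[OF s] by (auto simp: V_def)
    qed
  qed blast
  define X where "X = {z \<in> times D (\<Union>y\<in>el b. el y). \<exists>x\<in>C. \<exists>a\<in>C. z = pr M x a \<and> (\<exists>y\<in>C. V x y \<and> a \<in> el y)}"
  have sX: "is_set M X"
  proof (rule is_set_sep)
    show *: "is_set M (times D (\<Union>y\<in>el b. el y))"
      by (intro is_set_times is_set_Union is_set_els sD b(1))
    show "X \<subseteq> times D (\<Union>y\<in>el b. el y)" by (auto simp: X_def)
    show "dclass M (\<lambda>s. X)" unfolding X_def by (intro defn dV dclass_is_set[OF *])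
  qed
  define T0 where "T0 = cd M X"
  have T0: "T0 \<in> C" "el T0 = X" using sX by (simp_all add: T0_def cd_in els_cd)
  have secT0: "sec M T0 x = sec M T x" if "T \<in> C" "G x T" "x \<in> D" for x T
  proof -
    have "x \<in> C" using that(3) DC by blast
    obtain y where y: "y \<in> el b" "V x y" using b(2) \<open>x \<in> D\<close> by blast
    have V: "el y = sec M T x" if Vxy: "V x y" for y
    proof -
      obtain T' where "T' \<in> C" "G x T'" "el y = sec M T' x" using Vxy by (auto simp: V_def)
      then show ?thesis using agree \<open>T \<in> C\<close> \<open>G x T\<close> by metis
    qed
    have yC: "y \<in> C" using y(1) by (rule els_in_carr)
    show ?thesis
    proof
      show "sec M T0 x \<subseteq> sec M T x"
        unfolding sec_def[of M T0] T0(2) X_def using V \<open>x \<in> C\<close> by auto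
      show "sec M T x \<subseteq> sec M T0 x"
      proof
        fix a
        assume "a \<in> sec M T x"
        then have "a \<in> el y" "a \<in> C" using V[OF y(2)] sec_subset by auto
        then have "pr M x a \<in> X"
          unfolding X_def times_def using \<open>x \<in> C\<close> \<open>x \<in> D\<close> y yC by (auto simp: pr_in)
        then show "a \<in> sec M T0 x" using \<open>a \<in> C\<close> by (simp add: sec_def T0(2))
      qed
    qed
  qed
  have goodT0: "sec M T0 x = \<Phi> x (sec M T0)" if xD: "x \<in> D" for x
  proof -
    obtain T where T: "T \<in> C" "G x T" using xD by (auto simp: D_def)
    then obtain u where u: "u \<in> C" "good T u" "x \<in> el u" by (auto simp: G_def)
    have "\<forall>y\<in>el u. sec M T y = sec M T0 y"
    proof
      fix y
      assume "y \<in> el u"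
      then have "G y T" "y \<in> D" using u T by (auto simp: G_def D_def good_def)
      then show "sec M T y = sec M T0 y" using secT0[OF T(1)] by simp
    qed
    moreover have "trans_class M (el u)" "el x \<subseteq> el u" using u by (auto simp: good_def trans_class_def)
    ultimately have "\<Phi> x (sec M T) = \<Phi> x (sec M T0)"
      using local[OF is_set_els[OF u(1)]] that DC by blast
    then show ?thesis using secT0[OF T that] u by (auto simp: good_def)
  qed
  \<comment> \<open>An \<in>-minimal \<open>x\<close> outside \<open>D\<close> would be reached by
    \<open>T0\<close> extended with the pairs of \<open>x\<close> and the members of
    \<open>\<Phi> x (sec M T0)\<close>.\<close>
  have "D = el t"
  proof (rule ccontr)
    assume "D \<noteq> el t"
    then have "el t - D \<noteq> {}" by (auto simp: D_def)
    moreover have "is_set M (el t - D)"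
      by (rule is_set_sep[OF is_set_els[OF t(1)]]) (auto intro!: dclass_Diff dclass_is_set[OF sD] dclass_is_set[OF is_set_els[OF t(1)]])
    ultimately obtain x where x: "x \<in> el t - D" "el x \<inter> (el t - D) = {}" using foundation by metis
    then have xD: "el x \<subseteq> D" using t(2) by (auto simp: trans_class_def)
    have xC: "x \<in> C" using x tC by blast
    define Z where "Z = \<Phi> x (sec M T0)"
    have Z: "is_set M Z" unfolding Z_def using x by (intro set T0(1)) blast
    define Y where "Y = X \<union> times {x} Z"
    have sY: "is_set M Y"
      unfolding Y_def by (intro is_set_Un sX is_set_times is_set_single xC Z)
    define T1 where "T1 = cd M Y"
    have T1: "T1 \<in> C" "el T1 = Y" using sY by (simp_all add: T1_def cd_in els_cd)
    have 1: "sec M T1 y = sec M T0 y" if "y \<in> D" for y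
    proof -
      have "y \<in> C" "y \<noteq> x" using that DC x by auto
      then show ?thesis
        unfolding sec_def T1(2) T0(2) Y_def using xC is_set_subset[OF Z] by (auto simp: pr_in_times)
    qed
    have 2: "sec M T1 x = \<Phi> x (sec M T0)"
    proof -
      have "pr M x a \<notin> X" if "a \<in> C" for a
        using that x xC DC by (auto simp: X_def pr_in_times is_set_subset UN_subset_iff els_subset)
      then show ?thesis
        unfolding sec_def T1(2) Y_def Z_def[symmetric] using xC is_set_subset[OF Z]
        by (auto simp: pr_in_times subset_eq)
    qed
    have su: "is_set M (insert x D)" by (rule is_set_insert[OF xC sD])
    have tu: "trans_class M (insert x D)" using Dtr xD by (auto simp: trans_class_def)
    \<comment> \<open>\<open>T1\<close> and \<open>T0\<close> have the same sections on
      \<open>D\<close>, and \<open>D\<close> is transitive and contains all elements of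
      \<open>y\<close>.\<close>
    have *: "\<Phi> y (sec M T1) = \<Phi> y (sec M T0)" if "y \<in> insert x D" for y
    proof (rule local[OF sD Dtr])
      show "y \<in> C" using that xC DC by blast
      show "el y \<subseteq> D" using that xD Dtr by (auto simp: trans_class_def)
    qed (use 1 in blast)
    have "good T1 (cd M (insert x D))"
      unfolding good_def els_cd[OF su] using tu x * 1 2 goodT0 by (auto simp: D_def)
    then have "G x T1" unfolding G_def using cd_in[OF su] els_cd[OF su] by auto
    then show False using x T1(1) by (auto simp: D_def)
  qed
  then show thesis using that[OF T0(1)] goodT0 by blast
qed

end

section \<open>The cumulative hierarchy\<close>

text \<open>The union of the power sets of the members of \<open>X\<close>, which is how a level
  arises from the earlier ones.\<close>

definition subs :: "'a eps_struct \<Rightarrow> 'a set \<Rightarrow> 'a set" where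
  "subs M X = {y \<in> carr M. \<exists>c\<in>X. els M y \<subseteq> els M c}"

text \<open>Levels are the sets \<open>V\<^sub>\<alpha>\<close>, defined without ordinals (Scott, Potter, Button): a history is an
  initial part of the hierarchy, that is, a set of sets each of which consists of all subsets of its
  predecessors.\<close>

definition hist :: "'a eps_struct \<Rightarrow> 'a \<Rightarrow> bool" where
  "hist M h \<longleftrightarrow> (\<forall>x\<in>els M h. els M x = subs M (els M x \<inter> els M h))"

definition lev :: "'a eps_struct \<Rightarrow> 'a \<Rightarrow> bool" where
  "lev M s \<longleftrightarrow> s \<in> carr M \<and> (\<exists>h\<in>carr M. hist M h \<and> els M s = subs M (els M h))"

context zf
begin

section \<open>A substitute for \<omega> and transitive closures\<close>

lemma limit_set:
  obtains w where "w \<in> C" "trans_class M (el w)" "el w \<noteq> {}" "\<And>n. n \<in> el w \<Longrightarrow> \<exists>m\<in>el w. n \<in> el m"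
proof -
  obtain a where "a \<in> C" using carr_ne by blast
  then have "sat M (\<lambda>_. a) infinity_ax"
    by (intro sat_ax) (auto simp: ZF_def)
  then have "\<exists>i\<in>C. (\<exists>x\<in>C. eps M x i \<and> (\<forall>z\<in>C. \<not> eps M z x)) \<and>
      (\<forall>x\<in>C. eps M x i \<longrightarrow> (\<exists>y\<in>C. eps M y i \<and> (\<forall>z\<in>C. (eps M z y \<longrightarrow> eps M z x \<or> z = x) \<and> (\<not> eps M z x \<and> z \<noteq> x \<or> eps M z y))))"
    unfolding infinity_ax_def
    by simp
  then obtain i x where i: "i \<in> C" and x: "x \<in> C" "eps M x i" "\<forall>z\<in>C. \<not> eps M z x"
    and suc: "\<forall>x\<in>C. eps M x i \<longrightarrow> (\<exists>y\<in>C. eps M y i \<and> (\<forall>z\<in>C. (eps M z y \<longrightarrow> eps M z x \<or> z = x) \<and> (\<not> eps M z x \<and> z \<noteq> x \<or> eps M z y)))"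
    by blast
  have x': "x \<in> el i" "el x = {}" using x by (auto simp: els_def)
  have suc': "\<exists>y\<in>el i. el y = insert n (el n)" if "n \<in> el i" for n
  proof -
    have n: "n \<in> C" "eps M n i" using that by (auto simp: els_def)
    then obtain y where y: "y \<in> C" "eps M y i" "\<forall>z\<in>C. (eps M z y \<longrightarrow> eps M z n \<or> z = n) \<and> (\<not> eps M z n \<and> z \<noteq> n \<or> eps M z y)"
      using suc by blast
    then have "el y = insert n (el n)" using n by (auto simp: els_def)
    then show ?thesis using y by (auto simp: els_def)
  qed
  \<comment> \<open>The conditions pass from \<open>n\<close> to its elements, which makes
    \<open>W\<close> transitive, and to its successor, which leaves \<open>W\<close> without a last
    element.\<close>
  define W where "W = {n \<in> el i. el n \<subseteq> el i \<and> trans_class M (el n) \<and> (\<forall>m\<in>el n. trans_class M (el m))}"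
  have "is_set M W"
    by (rule is_set_sep[OF is_set_els[OF i]]) (unfold W_def, blast, intro defn i)
  then obtain w where w: "w \<in> C" "el w = W" by (auto simp: is_set_def)
  show thesis
  proof (rule that[OF w(1)])
    show "trans_class M (el w)" unfolding w(2) by (auto simp: W_def trans_class_def; blast)
    show "el w \<noteq> {}" unfolding w(2) using x' by (auto simp: W_def trans_class_def)
    fix n
    assume n: "n \<in> el w"
    then obtain y where "y \<in> el i" "el y = insert n (el n)" using suc' unfolding w(2) W_def by blast
    moreover have "y \<in> W" using n calculation unfolding w(2) by (auto simp: W_def trans_class_def)
    ultimately show "\<exists>m\<in>el w. n \<in> el m" unfolding w(2) by blast
  qed
qed

text \<open>Unions of \<open>a\<close> are iterated by recursion along \<open>w\<close>. If
  \<open>y\<close> is an element of a value at \<open>n\<close> and \<open>n\<close> is in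
  \<open>m\<close>, then \<open>y\<close> enters the value at \<open>m\<close>, so the union over
  \<open>w\<close> is transitive.\<close>

lemma trans_closure:
  assumes a: "a \<in> C"
  obtains t where "t \<in> C" "trans_class M (el t)" "el a \<subseteq> el t"
proof -
  obtain w where w: "w \<in> C" "trans_class M (el w)" "el w \<noteq> {}"
    "\<And>n. n \<in> el w \<Longrightarrow> \<exists>m\<in>el w. n \<in> el m" using limit_set by metis
  define \<Phi> where "\<Phi> n f = {z \<in> C. z \<in> el a \<or> (\<exists>m\<in>el n. \<exists>y\<in>f m. z \<in> el y)}" for n and f :: "'a \<Rightarrow> 'a set"
  obtain T where T: "T \<in> C" "\<And>x. x \<in> el w \<Longrightarrow> sec M T x = \<Phi> x (sec M T)"
  proof (rule recursion[OF w(1,2), of \<Phi>])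
    show "\<Phi> x f = \<Phi> x g" if "el x \<subseteq> u" "\<forall>y\<in>u. f y = g y" for x u f g
    proof -
      have "f m = g m" if "m \<in> el x" for m using that \<open>el x \<subseteq> u\<close> \<open>\<forall>y\<in>u. f y = g y\<close> by blast
      then show ?thesis by (simp add: \<Phi>_def)
    qed
    show "\<Phi> x f \<subseteq> C" for x f by (auto simp: \<Phi>_def)
    show d: "definable M (\<lambda>s. s 0 \<in> \<Phi> (s 1) (sec M (s 2)))"
      unfolding \<Phi>_def by (intro defn a)
    show "is_set M (\<Phi> x (sec M T))" if "x \<in> el w" "T \<in> C" for x T
    proof (rule is_set_sep)
      let ?B = "\<Union>x\<in>(\<Union>x\<in>el T. el x). el x"
      have "x \<in> C" using that(1) by (rule els_in_carr)
      show "is_set M (el a \<union> (\<Union>y\<in>?B. el y))"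
        by (intro is_set_Un is_set_Union is_set_els a \<open>T \<in> C\<close>)
      show "\<Phi> x (sec M T) \<subseteq> el a \<union> (\<Union>y\<in>?B. el y)"
        unfolding \<Phi>_def using sec_bounded[OF els_in_carr, of _ x T] by fast
      show "dclass M (\<lambda>s. \<Phi> x (sec M T))"
        unfolding \<Phi>_def by (intro defn a that \<open>x \<in> C\<close>)
    qed
  qed blast
  define X where "X = {z \<in> C. \<exists>n\<in>el w. z \<in> sec M T n}"
  have "is_set M X"
  proof (rule is_set_sep[OF is_set_sec_bound[OF T(1)]])
    show "X \<subseteq> (\<Union>x\<in>(\<Union>x\<in>el T. el x). el x)"
      unfolding X_def using sec_bounded[OF els_in_carr, of _ w T] by blast
    show "dclass M (\<lambda>s. X)" unfolding X_def by (intro defn w T)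
  qed
  then obtain t where t: "t \<in> C" "el t = X" by (auto simp: is_set_def)
  show thesis
  proof (rule that[OF t(1)])
    show "trans_class M (el t)"
      unfolding t(2) trans_class_def
    proof (intro ballI subsetI)
      fix x y
      assume "x \<in> X" and y: "y \<in> el x"
      then obtain n where n: "n \<in> el w" "x \<in> sec M T n" by (auto simp: X_def)
      then obtain m where m: "m \<in> el w" "n \<in> el m" using w(4) by blast
      have "y \<in> \<Phi> m (sec M T)" unfolding \<Phi>_def using y m n by (auto simp: els_in_carr)
      then show "y \<in> X" unfolding X_def using T(2)[OF m(1)] m(1) y by (auto simp: els_in_carr)
    qed
    obtain n where n: "n \<in> el w" using w(3) by blast
    have "el a \<subseteq> \<Phi> n (sec M T)" unfolding \<Phi>_def by (auto simp: els_in_carr)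
    then show "el a \<subseteq> el t" unfolding t(2) X_def using T(2)[OF n] n by (auto simp: els_in_carr)
  qed
qed

lemma not_self_mem:
  assumes "x \<in> C"
  shows "x \<notin> el x"
proof -
  obtain y where "y \<in> {x}" "el y \<inter> {x} = {}"
    by (rule foundation[OF is_set_single[OF assms]]) simp
  then show ?thesis by simp
qed

section \<open>Histories and levels\<close>

lemma definable_hist [defn]:
  assumes "dterm M t"
  shows "definable M (\<lambda>s. hist M (t s))"
proof -
  have "definable M (\<lambda>s. hist M (s 0))" unfolding hist_def subs_def by (intro defn)
  from definable_1[OF this assms] show ?thesis .
qed

lemma definable_lev [defn]:
  assumes "dterm M t"
  shows "definable M (\<lambda>s. lev M (t s))"
proof -
  have "definable M (\<lambda>s. lev M (s 0))" unfolding lev_def subs_def by (intro defn)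
  from definable_1[OF this assms] show ?thesis .
qed

lemma lev_in: "lev M s \<Longrightarrow> s \<in> C"
  by (simp add: lev_def)

lemma subs_downward: "z \<in> subs M X \<Longrightarrow> y \<in> C \<Longrightarrow> el y \<subseteq> el z \<Longrightarrow> y \<in> subs M X"
  by (auto simp: subs_def)

lemma subs_trans:
  assumes "X \<subseteq> C" "\<forall>x\<in>X. trans_class M (el x)"
  shows "trans_class M (subs M X)"
  unfolding trans_class_def
proof (intro ballI subsetI)
  fix z y
  assume "z \<in> subs M X" "y \<in> el z"
  then obtain c where "c \<in> X" "y \<in> el c" by (auto simp: subs_def)
  then have "el y \<subseteq> el c" using assms(2) by (auto simp: trans_class_def)
  then show "y \<in> subs M X" using \<open>c \<in> X\<close> els_in_carr[OF \<open>y \<in> el z\<close>] by (auto simp: subs_def)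
qed

text \<open>An \<in>-minimal intransitive member of \<open>h\<close> would be \<open>subs\<close> of
  transitive sets, hence transitive by \<open>subs_trans\<close>.\<close>

lemma hist_trans:
  assumes h: "h \<in> C" "hist M h" and x: "x \<in> el h"
  shows "trans_class M (el x)"
proof (rule ccontr)
  assume "\<not> trans_class M (el x)"
  define B where "B = {y \<in> el h. \<not> trans_class M (el y)}"
  have "is_set M B"
    by (rule is_set_sep[OF is_set_els[OF h(1)]]) (unfold B_def, blast, intro defn h)
  moreover have "B \<noteq> {}" using \<open>\<not> trans_class M (el x)\<close> x by (auto simp: B_def)
  ultimately obtain y where y: "y \<in> B" "el y \<inter> B = {}" by (rule foundation)
  have "trans_class M (subs M (el y \<inter> el h))"
    by (rule subs_trans) (use y in \<open>auto simp: B_def els_in_carr\<close>)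
  moreover have "el y = subs M (el y \<inter> el h)" using h(2) y(1) by (auto simp: hist_def B_def)
  ultimately show False using y(1) by (auto simp: B_def)
qed

lemma lev_trans:
  assumes "lev M s"
  shows "trans_class M (el s)"
proof -
  obtain h where h: "h \<in> C" "hist M h" "el s = subs M (el h)" using assms by (auto simp: lev_def)
  show ?thesis unfolding h(3)
    by (rule subs_trans) (use hist_trans[OF h(1,2)] els_subset[of M h] in auto)
qed

lemma lev_transD: "lev M s \<Longrightarrow> x \<in> el s \<Longrightarrow> y \<in> el x \<Longrightarrow> y \<in> el s"
  using lev_trans by (auto simp: trans_class_def)

lemma lev_downward: "lev M s \<Longrightarrow> z \<in> el s \<Longrightarrow> y \<in> C \<Longrightarrow> el y \<subseteq> el z \<Longrightarrow> y \<in> el s"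
  using subs_downward by (auto simp: lev_def)

text \<open>The part of \<open>h\<close> inside \<open>x\<close> is again a history: as
  \<open>x\<close> is transitive, its members have the same predecessors there as in
  \<open>h\<close>.\<close>

lemma hist_lev:
  assumes h: "h \<in> C" "hist M h" and x: "x \<in> el h"
  shows "lev M x"
proof -
  have s: "is_set M (el x \<inter> el h)"
    by (intro is_set_Int is_set_els els_in_carr[OF x] defn h(1))
  have "el y \<subseteq> el x" if "y \<in> el x" for y
    using hist_trans[OF h x] that by (auto simp: trans_class_def)
  then have "el y \<inter> (el x \<inter> el h) = el y \<inter> el h" if "y \<in> el x" for y using that by blast
  then have "hist M (cd M (el x \<inter> el h))"
    using h(2) unfolding hist_def els_cd[OF s] by auto
  moreover have "el x = subs M (el x \<inter> el h)" using h(2) x by (auto simp: hist_def)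
  ultimately show ?thesis unfolding lev_def using els_cd[OF s] cd_in[OF s] els_in_carr[OF x] by metis
qed

lemma lev_cover:
  assumes "lev M s" "z \<in> el s"
  obtains r where "lev M r" "r \<in> el s" "el z \<subseteq> el r"
proof -
  obtain h where h: "h \<in> C" "hist M h" "el s = subs M (el h)" using assms by (auto simp: lev_def)
  then obtain c where c: "c \<in> el h" "el z \<subseteq> el c" using assms by (auto simp: subs_def)
  have "c \<in> el s" unfolding h(3) subs_def using c els_in_carr[OF c(1)] by auto
  then show thesis using that hist_lev[OF h(1,2) c(1)] c by blast
qed

text \<open>Foundation extends from sets to classes of levels: below a member \<open>s\<close> of
  the class only the set \<open>el s \<inter> P\<close> matters, because \<open>s\<close> is
  transitive.\<close>

lemma lev_minimal:
  assumes "dclass M (\<lambda>s. P)" "P \<noteq> {}" "\<And>r. r \<in> P \<Longrightarrow> lev M r"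
  obtains r where "r \<in> P" "el r \<inter> P = {}"
proof -
  obtain s where s: "s \<in> P" using assms(2) by blast
  show thesis
  proof (cases "el s \<inter> P = {}")
    case True
    then show thesis using that s by blast
  next
    case False
    have "is_set M (el s \<inter> P)" by (rule is_set_Int[OF is_set_els[OF lev_in[OF assms(3)[OF s]]] assms(1)])
    then obtain r where r: "r \<in> el s \<inter> P" "el r \<inter> (el s \<inter> P) = {}" using False by (rule foundation)
    have "el r \<subseteq> el s" using lev_transD[OF assms(3)[OF s]] r(1) by blast
    then show thesis using that[of r] r by blast
  qed
qed

text \<open>An element \<open>z\<close> of \<open>r\<close> is contained in some level
  \<open>q\<close> of \<open>r\<close>. If \<open>s\<close> were contained in \<open>q\<close>, it
  would be in \<open>r\<close>; so \<open>q\<close> is in \<open>s\<close>, and \<open>z\<close>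
  with it.\<close>

lemma lev_comparable_step:
  assumes "lev M r" "lev M s" "\<And>q. lev M q \<Longrightarrow> q \<in> el r \<Longrightarrow> el s \<subseteq> el q \<or> q \<in> el s"
  shows "el r \<subseteq> el s \<or> s \<in> el r"
proof (rule disjCI)
  assume "s \<notin> el r"
  show "el r \<subseteq> el s"
  proof
    fix z
    assume z: "z \<in> el r"
    then obtain q where q: "lev M q" "q \<in> el r" "el z \<subseteq> el q" using lev_cover[OF assms(1)] by metis
    have "\<not> el s \<subseteq> el q" using lev_downward[OF assms(1) q(2) lev_in[OF assms(2)]] \<open>s \<notin> el r\<close> by blast
    then have "q \<in> el s" using assms(3)[OF q(1,2)] by blast
    then show "z \<in> el s" by (rule lev_downward[OF assms(2)]) (use q els_in_carr[OF z] in auto)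
  qed
qed

text \<open>Double induction with two minimal counterexamples, first \<open>r\<close> and then
  \<open>s\<close> for this \<open>r\<close>. Failure is taken in either order, so the minimality of
  \<open>r\<close> yields \<open>c r s\<close> and that of \<open>s\<close> yields
  \<open>c s r\<close>.\<close>

lemma lev_comparable:
  assumes "lev M r" "lev M s"
  shows "el r \<subseteq> el s \<or> s \<in> el r"
proof (rule ccontr)
  assume neg: "\<not> ?thesis"
  define c where "c r s \<longleftrightarrow> el r \<subseteq> el s \<or> s \<in> el r" for r s
  define P where "P = {r \<in> C. lev M r \<and> (\<exists>s\<in>C. lev M s \<and> \<not> (c r s \<and> c s r))}"
  have "dclass M (\<lambda>s. P)" unfolding P_def c_def by (intro defn)
  moreover have "P \<noteq> {}" using neg assms lev_in by (auto simp: P_def c_def)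
  moreover have "lev M p" if "p \<in> P" for p using that by (simp add: P_def)
  ultimately obtain r where r: "r \<in> P" "el r \<inter> P = {}" by (rule lev_minimal)
  define Q where "Q = {s \<in> C. lev M s \<and> \<not> (c r s \<and> c s r)}"
  have "r \<in> C" using r by (simp add: P_def)
  then have "dclass M (\<lambda>s. Q)" unfolding Q_def c_def by (intro defn)
  moreover have "Q \<noteq> {}" using r(1) by (auto simp: P_def Q_def)
  moreover have "lev M q" if "q \<in> Q" for q using that by (simp add: Q_def)
  ultimately obtain s where s: "s \<in> Q" "el s \<inter> Q = {}" by (rule lev_minimal)
  have rs: "lev M r" "lev M s" using r s by (auto simp: P_def Q_def)
  have "c r s" unfolding c_def
  proof (rule lev_comparable_step[OF rs])
    fix q
    assume "lev M q" "q \<in> el r"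
    then have "q \<notin> P" using r by blast
    then show "el s \<subseteq> el q \<or> q \<in> el s"
      using \<open>lev M q\<close> rs(2) lev_in unfolding P_def c_def by blast
  qed
  moreover have "c s r" unfolding c_def
  proof (rule lev_comparable_step[OF rs(2,1)])
    fix q
    assume "lev M q" "q \<in> el s"
    then have "q \<notin> Q" using s by blast
    then show "el r \<subseteq> el q \<or> q \<in> el r"
      using \<open>lev M q\<close> lev_in unfolding Q_def c_def by blast
  qed
  ultimately show False using s by (auto simp: Q_def)
qed

lemma lev_least:
  assumes "dclass M (\<lambda>s. P)" "P \<noteq> {}" "\<And>r. r \<in> P \<Longrightarrow> lev M r"
  obtains r where "r \<in> P" "\<forall>q\<in>P. el r \<subseteq> el q"
proof -
  obtain r where "r \<in> P" "el r \<inter> P = {}" using lev_minimal[OF assms] by blast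
  then show thesis using that[of r] lev_comparable assms(3) by blast
qed

section \<open>Every element lies in a level\<close>

lemma is_set_subs:
  assumes "is_set M X"
  shows "is_set M (subs M X)"
proof (rule is_set_sep)
  show "is_set M {y \<in> C. el y \<subseteq> (\<Union>c\<in>X. el c)}" by (intro is_set_Pow is_set_Union assms)
  show "subs M X \<subseteq> {y \<in> C. el y \<subseteq> (\<Union>c\<in>X. el c)}" by (auto simp: subs_def)
  show "dclass M (\<lambda>s. subs M X)" unfolding subs_def by (intro defn dclass_is_set[OF assms])
qed

text \<open>The levels in \<open>B\<close> together with all levels below them form a history
  \<open>H\<close>, since \<open>H\<close> is closed under earlier levels; \<open>subs M H\<close>
  is then a level above \<open>B\<close>.\<close>

lemma lev_above_set:
  assumes B: "is_set M B" "\<And>r. r \<in> B \<Longrightarrow> lev M r"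
  obtains s where "lev M s" "B \<subseteq> el s"
proof -
  define H where "H = {l \<in> C. lev M l \<and> (\<exists>r\<in>B. l \<in> el r \<or> l = r)}"
  have sH: "is_set M H"
  proof (rule is_set_sep)
    show "is_set M ((\<Union>r\<in>B. el r) \<union> B)" by (intro is_set_Un is_set_Union B(1))
    show "H \<subseteq> (\<Union>r\<in>B. el r) \<union> B" by (auto simp: H_def)
    show "dclass M (\<lambda>s. H)" unfolding H_def by (intro defn dclass_is_set[OF B(1)])
  qed
  define h where "h = cd M H"
  have h: "h \<in> C" "el h = H" using sH by (simp_all add: h_def cd_in els_cd)
  have down: "q \<in> H" if q: "lev M q" "q \<in> el x" "x \<in> H" for q x
  proof -
    obtain r where "r \<in> B" "x \<in> el r \<or> x = r" using q(3) by (auto simp: H_def)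
    moreover from this have "q \<in> el r" using q(2) lev_transD[OF B(2)] by blast
    ultimately show ?thesis using q(1) lev_in by (auto simp: H_def)
  qed
  have "hist M h"
    unfolding hist_def h(2)
  proof (intro ballI set_eqI iffI)
    fix x y
    assume x: "x \<in> H" and y: "y \<in> el x"
    have "lev M x" using x by (simp add: H_def)
    then obtain r where "lev M r" "r \<in> el x" "el y \<subseteq> el r" using y by (rule lev_cover)
    then show "y \<in> subs M (el x \<inter> H)"
      unfolding subs_def using down[OF _ _ x] els_in_carr[OF y] by blast
  next
    fix x y
    assume x: "x \<in> H" and y: "y \<in> subs M (el x \<inter> H)"
    then show "y \<in> el x" using lev_downward[of x] unfolding subs_def H_def by blast
  qed
  define s where "s = cd M (subs M H)"
  have s: "s \<in> C" "el s = subs M H" using is_set_subs[OF sH] by (simp_all add: s_def cd_in els_cd)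
  have "lev M s" unfolding lev_def using s h \<open>hist M h\<close> by auto
  moreover have "B \<subseteq> el s"
    unfolding s(2) subs_def H_def using B(2) lev_in by blast
  ultimately show thesis by (rule that)
qed

text \<open>Take an \<in>-minimal \<open>y\<close> without a level in
  \<open>insert a (el t)\<close>. Its elements have levels, replacement gathers these into a set,
  and a level above that set contains \<open>y\<close> as a subset.\<close>

lemma ex_lev:
  assumes a: "a \<in> C"
  obtains s where "lev M s" "a \<in> el s"
proof (rule ccontr)
  assume "\<not> thesis"
  then have a_no: "\<not> (\<exists>s\<in>C. lev M s \<and> a \<in> el s)" using that by blast
  obtain t where t: "t \<in> C" "trans_class M (el t)" "el a \<subseteq> el t" using trans_closure[OF a] by blast
  define B where "B = {y \<in> insert a (el t). \<not> (\<exists>s\<in>C. lev M s \<and> y \<in> el s)}"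
  have st: "is_set M (insert a (el t))" by (intro is_set_insert is_set_els a t(1))
  have "is_set M B"
    by (rule is_set_sep[OF st]) (unfold B_def, blast, intro defn dclass_is_set[OF st])
  moreover have "B \<noteq> {}" using a_no by (auto simp: B_def)
  ultimately obtain y where y: "y \<in> B" "el y \<inter> B = {}" by (rule foundation)
  have yC: "y \<in> C" using y(1) a els_in_carr by (auto simp: B_def)
  have "el y \<subseteq> el t" using y(1) t by (auto simp: B_def trans_class_def)
  then have ely: "\<exists>s\<in>C. lev M s \<and> z \<in> el s" if "z \<in> el y" for z using y(2) that by (auto simp: B_def)
  \<comment> \<open>Replacement asks for a function, hence the least level that contains
    \<open>z\<close>.\<close>
  define R where "R z l \<longleftrightarrow> lev M l \<and> z \<in> el l \<and> (\<forall>k\<in>C. lev M k \<and> z \<in> el k \<longrightarrow> el l \<subseteq> el k)" for z l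
  have dR: "definable M (\<lambda>s. R (s 0) (s 1))" unfolding R_def by (intro defn)
  have uR: "\<exists>l\<in>C. \<forall>k\<in>C. R z k \<longleftrightarrow> k = l" if z: "z \<in> el y" for z
  proof -
    have "dclass M (\<lambda>s. {l \<in> C. lev M l \<and> z \<in> el l})" by (intro defn els_in_carr[OF z])
    moreover have "{l \<in> C. lev M l \<and> z \<in> el l} \<noteq> {}" using ely[OF z] by blast
    moreover have "lev M l" if "l \<in> {l \<in> C. lev M l \<and> z \<in> el l}" for l using that by blast
    ultimately obtain r where r: "r \<in> {l \<in> C. lev M l \<and> z \<in> el l}"
      "\<forall>q\<in>{l \<in> C. lev M l \<and> z \<in> el l}. el r \<subseteq> el q" by (rule lev_least)
    show ?thesis
    proof (intro bexI ballI iffI)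
      show "r \<in> C" using r by blast
      fix k
      assume k: "k \<in> C"
      {
        assume "R z k"
        then have "el k \<subseteq> el r" "el r \<subseteq> el k" using r k by (auto simp: R_def)
        then show "k = r" using extensional k r(1) by blast
      }
      assume "k = r"
      then show "R z k" using r by (auto simp: R_def)
    qed
  qed
  obtain b where b: "b \<in> C" "\<forall>z\<in>el y. \<exists>l\<in>el b. R z l"
    by (rule replacement[OF is_set_els[OF yC] dR uR]) blast+
  have "is_set M {l \<in> el b. lev M l}"
    by (rule is_set_sep[OF is_set_els[OF b(1)]]) (blast, intro defn b(1))
  then obtain s where s: "lev M s" "{l \<in> el b. lev M l} \<subseteq> el s" using lev_above_set by blast
  have "el y \<subseteq> el s"
  proof
    fix z
    assume "z \<in> el y"
    then obtain l where "l \<in> el b" "R z l" using b(2) by blast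
    then show "z \<in> el s" using s lev_transD[OF s(1), of l z] by (auto simp: R_def)
  qed
  \<comment> \<open>One further level turns \<open>y\<close> from a subset into an element.\<close>
  moreover obtain s' where s': "lev M s'" "{s} \<subseteq> el s'"
    using lev_above_set[OF is_set_single[OF lev_in[OF s(1)]]] s(1) by blast
  ultimately have "y \<in> el s'" using lev_downward[OF s'(1), of s y] yC by blast
  then show False using y(1) s'(1) lev_in by (auto simp: B_def)
qed

end

section \<open>Conservative end extensions\<close>

text \<open>The update of an assignment coded as a set of pairs; dropping every old pair at
  \<open>v\<close> makes the new value there unique.\<close>

definition upd :: "'a eps_struct \<Rightarrow> 'a \<Rightarrow> 'a \<Rightarrow> 'a \<Rightarrow> 'a" where
  "upd M e v a = cd M {z \<in> carr M. z \<in> els M e \<and> \<not> (\<exists>b\<in>carr M. z = pr M v b) \<or> z = pr M v a}"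

text \<open>Passes from interleaved parameters to a single assignment, the form used by
  \<open>param_definable\<close>.\<close>

lemma dclass_formula:
  assumes "dclass M (\<lambda>s. X)" "carr M \<noteq> {}"
  obtains p s where "range s \<subseteq> carr M" "X = {a \<in> carr M. sat M (s(0 := a)) p}"
proof -
  have "definable M (\<lambda>s. s 0 \<in> X)" using assms(1) by (simp add: dclass_def)
  then obtain p e where e: "range e \<subseteq> carr M"
      and p: "\<And>s. range s \<subseteq> carr M \<Longrightarrow> s 0 \<in> X \<longleftrightarrow> sat M (interleave s e) p"
    unfolding definable_def by blast
  obtain c where c: "c \<in> carr M" using assms(2) by blast
  define s where "s = interleave (\<lambda>_. c) e"
  have "a \<in> X \<longleftrightarrow> sat M (s(0 := a)) p" if a: "a \<in> carr M" for a
  proof -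
    have "interleave ((\<lambda>_. c)(0 := a)) e = s(0 := a)"
      by (rule ext) (auto simp: s_def interleave_def elim!: evenE)
    moreover have r: "range ((\<lambda>_. c)(0 := a)) \<subseteq> carr M" using a c by auto
    ultimately show ?thesis using p[OF r] by simp
  qed
  then have "X = {a \<in> carr M. sat M (s(0 := a)) p}" using dclass_subset[OF assms(1)] by auto
  moreover have "range s \<subseteq> carr M" using e c by (auto simp: s_def interleave_def)
  ultimately show thesis using that by blast
qed

lemma param_definable_dclass:
  assumes "param_definable M D"
  shows "dclass M (\<lambda>s. D)"
proof -
  obtain p x s where s: "range s \<subseteq> carr M" "D = {a \<in> carr M. sat M (s(x := a)) p}"
    using assms by (auto simp: param_definable_def)
  have "definable M (\<lambda>s'. sat M (s(x := s' 0)) p)"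
  proof (rule definableI[of s _ _ "\<lambda>n. if n = x then 0 else Suc (2 * n)" p])
    fix s'
    have "s(x := s' 0) = (\<lambda>n. interleave s' s (if n = x then 0 else Suc (2 * n)))"
      by (auto simp: interleave_def)
    then show "sat M (s(x := s' 0)) p \<longleftrightarrow> sat M (\<lambda>n. interleave s' s (if n = x then 0 else Suc (2 * n))) p"
      by simp
  qed (rule s)
  then show ?thesis unfolding s(2) by (rule dclass_Collect)
qed

context zf
begin

lemma dterm_cd:
  fixes X :: "(nat \<Rightarrow> 'a) \<Rightarrow> 'a set"
  assumes "dclass M X" "\<And>s. range s \<subseteq> C \<Longrightarrow> is_set M (X s)"
  shows "dterm M (\<lambda>s. cd M (X s))"
proof -
  have "definable M (\<lambda>s. s 0 = cd M (X (\<lambda>n. s (Suc n))))"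
  proof (rule definable_cong)
    show "definable M (\<lambda>s. el (s 0) = X (\<lambda>n. s (Suc n)))"
      by (rule definable_set_eq[OF dclass_els[OF dterm_var'] dclass_rename[OF assms(1)]])
    fix s :: "nat \<Rightarrow> 'a"
    assume s: "range s \<subseteq> C"
    then have *: "is_set M (X (\<lambda>n. s (Suc n)))" "s 0 \<in> C" by (auto intro!: assms(2))
    then show "s 0 = cd M (X (\<lambda>n. s (Suc n))) \<longleftrightarrow> el (s 0) = X (\<lambda>n. s (Suc n))"
      using els_cd cd_els by metis
  qed
  then show ?thesis using assms(2) cd_in by (auto simp: dterm_def)
qed

lemma is_set_upd:
  assumes "e \<in> C" "v \<in> C" "a \<in> C"
  shows "is_set M {z \<in> C. z \<in> el e \<and> \<not> (\<exists>b\<in>C. z = pr M v b) \<or> z = pr M v a}"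
proof (rule is_set_sep)
  show "is_set M (insert (pr M v a) (el e))" by (intro is_set_insert is_set_els pr_in assms)
  show "dclass M (\<lambda>s. {z \<in> C. z \<in> el e \<and> \<not> (\<exists>b\<in>C. z = pr M v b) \<or> z = pr M v a})"
    by (intro defn pr_in assms)
qed auto

lemma upd_in: "e \<in> C \<Longrightarrow> v \<in> C \<Longrightarrow> a \<in> C \<Longrightarrow> upd M e v a \<in> C"
  unfolding upd_def by (rule cd_in[OF is_set_upd])

lemma els_upd:
  assumes "e \<in> C" "v \<in> C" "a \<in> C"
  shows "el (upd M e v a) = {z \<in> C. z \<in> el e \<and> \<not> (\<exists>b\<in>C. z = pr M v b) \<or> z = pr M v a}"
  unfolding upd_def by (rule els_cd[OF is_set_upd[OF assms]])

lemma dterm_upd [defn]: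
  assumes "dterm M t" "dterm M u" "dterm M v"
  shows "dterm M (\<lambda>s. upd M (t s) (u s) (v s))"
  unfolding upd_def
proof (rule dterm_cd)
  note r = assms[THEN dterm_rename, of Suc] assms[THEN dterm_rename, of "\<lambda>n. Suc (Suc n)"]
  show "dclass M (\<lambda>s. {z \<in> C. z \<in> el (t s) \<and> \<not> (\<exists>b\<in>C. z = pr M (u s) b) \<or> z = pr M (u s) (v s)})"
    by (intro defn r)
  show "is_set M {z \<in> C. z \<in> el (t s) \<and> \<not> (\<exists>b\<in>C. z = pr M (u s) b) \<or> z = pr M (u s) (v s)}"
    if "range s \<subseteq> C" for s
    using that assms by (intro is_set_upd) (auto simp: dterm_def)
qed

lemma is_set_finite: "finite X \<Longrightarrow> X \<subseteq> C \<Longrightarrow> is_set M X"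
  by (induction rule: finite_induct) (auto intro: is_set_empty is_set_insert)

text \<open>Provides the injection \<open>j\<close> for variables and tags. A finite carrier would
  be coded by an element of itself.\<close>

lemma infinite_carr: "infinite C"
proof
  assume "finite C"
  then obtain c where "c \<in> C" "el c = C" using is_set_finite[of C] by (auto simp: is_set_def)
  then show False using not_self_mem by blast
qed

end

locale cons_ext = M: zf M + N: zf N for M N :: "'a eps_struct" +
  assumes proper: "proper_end_extension M N" and cons: "conservative_extension M N"
begin

lemma carr_subset: "x \<in> carr M \<Longrightarrow> x \<in> carr N"
  using proper by (auto simp: proper_end_extension_def end_extension_def submodel_def)

lemma els_ext: "a \<in> carr M \<Longrightarrow> els N a = els M a"
  using proper unfolding proper_end_extension_def end_extension_def els_def by blast

lemma in_els_M: "a \<in> carr M \<Longrightarrow> x \<in> els N a \<Longrightarrow> x \<in> carr M"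
  using els_ext M.els_in_carr by blast

lemma is_set_ext:
  assumes "is_set M X"
  shows "is_set N X" "cd N X = cd M X"
proof -
  obtain b where b: "b \<in> carr M" "els M b = X" using assms by (auto simp: is_set_def)
  then have b': "b \<in> carr N" "els N b = X" using carr_subset els_ext by auto
  then show "is_set N X" by (auto simp: is_set_def)
  show "cd N X = cd M X" using M.cd_els[OF b(1)] N.cd_els[OF b'(1)] b b' by simp
qed

lemma pr_ext: "a \<in> carr M \<Longrightarrow> b \<in> carr M \<Longrightarrow> pr N a b = pr M a b"
  unfolding pr_def
  by (simp add: is_set_ext(2) M.is_set_upair M.is_set_single M.cd_in)

lemma pr_in_M: "a \<in> carr M \<Longrightarrow> b \<in> carr M \<Longrightarrow> pr N a b \<in> carr M"
  by (simp add: pr_ext M.pr_in)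

lemma dclass_cons:
  assumes "dclass N (\<lambda>s. X)"
  shows "dclass M (\<lambda>s. X \<inter> carr M)"
proof -
  obtain p s where "range s \<subseteq> carr N" "X = {a \<in> carr N. sat N (s(0 := a)) p}"
    using dclass_formula[OF assms N.carr_ne] by blast
  then have "param_definable N X" by (auto simp: param_definable_def)
  then show ?thesis
    using cons param_definable_dclass by (auto simp: conservative_extension_def)
qed

text \<open>Conservativity speaks of sets, so a binary relation is first coded as a set of pairs;
  for elements of \<open>M\<close> the pairs of \<open>M\<close> and \<open>N\<close>
  coincide.\<close>

lemma definable_cons:
  assumes "definable N (\<lambda>s. R (s 0) (s 1))"
  shows "definable M (\<lambda>s. R (s 0) (s 1))"
proof -
  define X where "X = {z \<in> carr N. \<exists>x\<in>carr N. \<exists>y\<in>carr N. z = pr N x y \<and> R x y}"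
  have "dclass N (\<lambda>s. X)" unfolding X_def by (intro defn definable_2[OF assms])
  then have dX: "dclass M (\<lambda>s. X \<inter> carr M)" by (rule dclass_cons)
  show ?thesis
  proof (rule definable_cong)
    show "definable M (\<lambda>s. pr M (s 0) (s 1) \<in> X \<inter> carr M)" by (intro definable_in dX defn)
    fix s :: "nat \<Rightarrow> 'a"
    assume "range s \<subseteq> carr M"
    then have s: "s 0 \<in> carr M" "s 1 \<in> carr M" by auto
    have "pr N (s 0) (s 1) \<in> X \<longleftrightarrow> R (s 0) (s 1)"
      unfolding X_def using s by (auto simp: N.pr_in carr_subset)
    then show "R (s 0) (s 1) \<longleftrightarrow> pr M (s 0) (s 1) \<in> X \<inter> carr M"
      using s by (simp add: M.pr_in pr_ext)
  qed
qed

text \<open>By conservativity the elements of \<open>x\<close> form a class of \<open>M\<close>,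
  bounded by \<open>m\<close>, so separation in \<open>M\<close> gives them a code, and
  extensionality in \<open>N\<close> identifies this code with \<open>x\<close>.\<close>

lemma subset_in_M:
  assumes "x \<in> carr N" "m \<in> carr M" "els N x \<subseteq> els N m"
  shows "x \<in> carr M"
proof -
  have "dclass N (\<lambda>s. els N x)" by (intro defn assms)
  then have "is_set M (els M m \<inter> (els N x \<inter> carr M))"
    using M.is_set_Int[OF M.is_set_els[OF assms(2)] dclass_cons] by blast
  moreover have "els M m \<inter> (els N x \<inter> carr M) = els N x"
    using assms els_ext M.els_in_carr by blast
  ultimately obtain y where y: "y \<in> carr M" "els M y = els N x" by (auto simp: is_set_def)
  then have "x = y" using N.extensional[OF assms(1) carr_subset] els_ext by simp
  then show ?thesis using y by simp
qed

lemma subs_ext: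
  assumes "X \<subseteq> carr M"
  shows "subs N X = subs M X"
proof
  show "subs N X \<subseteq> subs M X"
  proof
    fix y
    assume "y \<in> subs N X"
    then obtain c where c: "y \<in> carr N" "c \<in> X" "els N y \<subseteq> els N c" by (auto simp: subs_def)
    then have "y \<in> carr M" using subset_in_M assms by blast
    then show "y \<in> subs M X" using c els_ext assms by (auto simp: subs_def)
  qed
  show "subs M X \<subseteq> subs N X"
    using assms els_ext carr_subset by (fastforce simp: subs_def)
qed

text \<open>A history of \<open>M\<close> remains one in \<open>N\<close>, because by
  \<open>subset_in_M\<close> no new subsets appear and \<open>subs\<close> is the same in both
  models.\<close>

lemma lev_ext:
  assumes "lev M s"
  shows "lev N s"
proof -
  obtain h where h: "h \<in> carr M" "hist M h" "els M s = subs M (els M h)" "s \<in> carr M"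
    using assms by (auto simp: lev_def)
  have "hist N h"
    unfolding hist_def els_ext[OF h(1)]
  proof
    fix x
    assume x: "x \<in> els M h"
    then have "x \<in> carr M" by (rule M.els_in_carr)
    moreover have "subs N (els M x \<inter> els M h) = subs M (els M x \<inter> els M h)"
      by (rule subs_ext) (auto simp: M.els_in_carr)
    ultimately show "els N x = subs N (els N x \<inter> els M h)"
      using h(2) x by (simp add: els_ext hist_def)
  qed
  moreover have "els N s = subs N (els N h)"
    using h subs_ext[OF els_subset] by (simp add: els_ext)
  ultimately show ?thesis using h carr_subset by (auto simp: lev_def)
qed

text \<open>Each \<open>x\<close> in \<open>M\<close> lies in a level \<open>K\<close> of
  \<open>M\<close>. The new level \<open>L\<close> is not contained in \<open>K\<close>, as it would
  then belong to \<open>M\<close>; hence \<open>K\<close> is an element of \<open>L\<close>.\<close>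

lemma new_lev_above:
  assumes "lev N L" "L \<notin> carr M"
  shows "carr M \<subseteq> els N L"
proof
  fix x
  assume x: "x \<in> carr M"
  then obtain K where K: "lev M K" "x \<in> els M K" by (rule M.ex_lev)
  then have "K \<in> carr M" "lev N K" by (simp_all add: M.lev_in lev_ext)
  then have "\<not> els N L \<subseteq> els N K" using subset_in_M[OF N.lev_in[OF assms(1)]] assms(2) by blast
  then have "K \<in> els N L" using N.lev_comparable[OF assms(1) \<open>lev N K\<close>] by blast
  then show "x \<in> els N L"
    using N.lev_transD[OF assms(1)] K(2) els_ext[OF \<open>K \<in> carr M\<close>] by blast
qed

lemma ex_new_lev:
  obtains A where "lev N A" "A \<notin> carr M"
proof -
  obtain b where b: "b \<in> carr N" "b \<notin> carr M"
    using proper carr_subset by (auto simp: proper_end_extension_def)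
  obtain A where A: "lev N A" "b \<in> els N A" using b(1) by (rule N.ex_lev)
  then show thesis using that b(2) in_els_M by blast
qed

text \<open>The update is a subset of \<open>e\<close> with one pair added, and the latter is a set
  of \<open>M\<close>.\<close>

lemma upd_in_M:
  assumes "e \<in> carr M" "v \<in> carr M" "a \<in> carr M"
  shows "upd N e v a \<in> carr M"
proof -
  have *: "is_set M (insert (pr M v a) (els M e))"
    by (intro M.is_set_insert M.is_set_els M.pr_in assms)
  show ?thesis
  proof (rule subset_in_M[OF _ M.cd_in[OF *]])
    show "upd N e v a \<in> carr N" using assms by (intro N.upd_in carr_subset)
    show "els N (upd N e v a) \<subseteq> els N (cd M (insert (pr M v a) (els M e)))"
      unfolding els_ext[OF M.cd_in[OF *]] M.els_cd[OF *]
      using assms by (auto simp: N.els_upd carr_subset els_ext pr_ext)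
  qed
qed

end

section \<open>A satisfaction class\<close>

locale sat_ext = cons_ext M N for M N :: "'a eps_struct" +
  fixes A :: 'a and j :: "nat \<Rightarrow> 'a"
  assumes A: "lev N A" "A \<notin> carr M" and j: "inj j" "range j \<subseteq> carr M"
begin

text \<open>The codes of assignments are confined to relations on \<open>A\<close> so that they form
  a set of \<open>N\<close>, which bounds every value of \<open>Phi\<close>.\<close>

definition env :: "'a set" where
  "env = {e \<in> carr N. els N e \<subseteq> N.times (els N A) (els N A)}"

text \<open>An existential statement \<open>u = (v, (c, e))\<close> asks for a value \<open>b\<close> of the variable \<open>v\<close> that makes \<open>c\<close>
  true under the assignment \<open>e\<close>. Assignments are elements of \<open>N\<close>, sets of pairs of a variable and a
  value. Any injection \<open>j\<close> of the natural numbers into \<open>M\<close> provides variables and tags: no coding of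
  numbers is needed, as only standard formulas matter.\<close>

definition wit :: "('a \<Rightarrow> 'a set) \<Rightarrow> 'a \<Rightarrow> 'a \<Rightarrow> bool" where
  "wit f u L \<longleftrightarrow> (\<exists>v\<in>carr N. \<exists>c\<in>carr N. \<exists>e\<in>carr N. u = pr N v (pr N c e) \<and>
     (\<exists>b\<in>els N A. els N b \<subseteq> els N L \<and> upd N e v b \<in> f c))"

text \<open>As levels are linearly ordered, this intersection is the least witnessing level, and
  without a witness it defaults to \<open>A\<close>; see \<open>rho_lev\<close>.\<close>

definition rho :: "('a \<Rightarrow> 'a set) \<Rightarrow> 'a \<Rightarrow> 'a set" where
  "rho f u = {x \<in> els N A. \<forall>L\<in>carr N. lev N L \<and> wit f u L \<longrightarrow> x \<in> els N L}"

text \<open>The four codes are membership, equality, not-and, and a quantifier bounded by \<open>\<rho> u\<close>. Letting the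
  codes of quantifiers mention earlier statements \<open>u\<close> makes the bounds closed under taking least levels
  of witnesses.\<close>

definition Phi :: "'a \<Rightarrow> ('a \<Rightarrow> 'a set) \<Rightarrow> 'a set" where
  "Phi c f = {e \<in> env.
     (\<exists>v\<in>carr N. \<exists>w\<in>carr N. c = pr N (j 0) (pr N v w) \<and>
        (\<exists>a\<in>carr N. \<exists>b\<in>carr N. pr N v a \<in> els N e \<and> pr N w b \<in> els N e \<and> a \<in> els N b)) \<or>
     (\<exists>v\<in>carr N. \<exists>w\<in>carr N. c = pr N (j 1) (pr N v w) \<and>
        (\<exists>a\<in>carr N. pr N v a \<in> els N e \<and> pr N w a \<in> els N e)) \<or>
     (\<exists>d\<in>carr N. \<exists>d'\<in>carr N. c = pr N (j 2) (pr N d d') \<and> \<not> (e \<in> f d \<and> e \<in> f d')) \<or>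
     (\<exists>u\<in>carr N. \<exists>v\<in>carr N. \<exists>d\<in>carr N. c = pr N (j 3) (pr N u (pr N v d)) \<and>
        (\<exists>a\<in>rho f u. upd N e v a \<in> f d))}"

lemma A_in: "A \<in> carr N"
  by (rule N.lev_in[OF A(1)])

lemma M_subset_A: "x \<in> carr M \<Longrightarrow> x \<in> els N A"
  using new_lev_above[OF A] by blast

lemma j_in: "j n \<in> carr M" "j n \<in> carr N"
  using j(2) carr_subset by auto

lemma j_eq: "j m = j n \<longleftrightarrow> m = n"
  using j(1) by (auto simp: inj_def)

lemma is_set_env: "is_set N env"
  unfolding env_def by (intro N.is_set_Pow N.is_set_times N.is_set_els A_in)

lemma definable_wit: "definable N (\<lambda>s. wit (sec N (s 0)) (s 1) (s 2))"
  unfolding wit_def by (intro defn A_in)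

lemma definable_rho: "definable N (\<lambda>s. s 0 \<in> rho (sec N (s 1)) (s 2))"
  unfolding rho_def by (intro defn A_in definable_3[OF definable_wit])

lemma dclass_rho [defn]:
  assumes "dterm N t" "dterm N u"
  shows "dclass N (\<lambda>s. rho (sec N (t s)) (u s))"
  unfolding dclass_def
  using definable_3[OF definable_rho N.dterm_var' dterm_rename[OF assms(1)] dterm_rename[OF assms(2)]]
  by (auto simp: rho_def N.els_in_carr)

lemma dclass_Phi [defn]:
  assumes "dterm N t" "dterm N u"
  shows "dclass N (\<lambda>s. Phi (t s) (sec N (u s)))"
proof -
  have "definable N (\<lambda>s. s 0 \<in> Phi (s 1) (sec N (s 2)))"
    unfolding Phi_def by (intro defn j_in N.dclass_is_set[OF is_set_env])
  from definable_3[OF this N.dterm_var' dterm_rename[OF assms(1)] dterm_rename[OF assms(2)]]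
  show ?thesis unfolding dclass_def by (auto simp: Phi_def env_def)
qed

lemma pr_trans:
  assumes "trans_class N W" "els N (pr N x y) \<subseteq> W" "x \<in> carr N" "y \<in> carr N"
  shows "x \<in> W" "y \<in> W" "els N x \<subseteq> W" "els N y \<subseteq> W"
proof -
  have "cd N {x, y} \<in> W" using assms by (simp add: N.els_pr)
  then have "els N (cd N {x, y}) \<subseteq> W" using assms(1) by (auto simp: trans_class_def)
  then show "x \<in> W" "y \<in> W" using assms(3,4) by (simp_all add: N.els_cd N.is_set_upair)
  then show "els N x \<subseteq> W" "els N y \<subseteq> W" using assms(1) by (auto simp: trans_class_def)
qed

lemma rho_cong:
  assumes "trans_class N W" "els N u \<subseteq> W" "\<forall>y\<in>W. f y = g y"
  shows "rho f u = rho g u"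
proof -
  have "f c = g c" if "u = pr N v (pr N c e)" "v \<in> carr N" "c \<in> carr N" "e \<in> carr N" for v c e
  proof -
    have "els N (pr N c e) \<subseteq> W" using pr_trans(4)[OF assms(1)] assms(2) that N.pr_in by blast
    then have "c \<in> W" using pr_trans(1)[OF assms(1)] that by blast
    then show ?thesis using assms(3) by blast
  qed
  then have "wit f u L = wit g u L" for L unfolding wit_def by metis
  then show ?thesis unfolding rho_def by simp
qed

text \<open>\<open>Phi\<close> consults \<open>f\<close> only at codes nested in the pairs that make
  up \<open>c\<close>, and a transitive \<open>W\<close> around the elements of \<open>c\<close>
  contains these codes by \<open>pr_trans\<close>.\<close>

lemma Phi_local:
  assumes W: "trans_class N W" "els N c \<subseteq> W" "\<forall>y\<in>W. f y = g y"
  shows "Phi c f = Phi c g"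
proof -
  have nand: "f d = g d \<and> f d' = g d'"
    if "c = pr N (j 2) (pr N d d')" "d \<in> carr N" "d' \<in> carr N" for d d'
  proof -
    have "els N (pr N d d') \<subseteq> W" using pr_trans(4)[OF W(1)] W(2) that N.pr_in j_in by blast
    then have "d \<in> W" "d' \<in> W" using pr_trans(1,2)[OF W(1)] that by blast+
    then show ?thesis using W(3) by blast
  qed
  have ex: "rho f u = rho g u \<and> f d = g d"
    if "c = pr N (j 3) (pr N u (pr N v d))" "u \<in> carr N" "v \<in> carr N" "d \<in> carr N" for u v d
  proof -
    have *: "els N (pr N u (pr N v d)) \<subseteq> W" using pr_trans(4)[OF W(1)] W(2) that N.pr_in j_in by blast
    then have "els N u \<subseteq> W" using pr_trans(3)[OF W(1)] that N.pr_in by blast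
    moreover have "els N (pr N v d) \<subseteq> W" using pr_trans(4)[OF W(1)] * that N.pr_in by blast
    then have "d \<in> W" using pr_trans(2)[OF W(1)] that by blast
    ultimately show ?thesis using rho_cong[OF W(1) _ W(3)] W(3) by blast
  qed
  show ?thesis
    unfolding Phi_def
    by (intro Collect_cong conj_cong refl disj_cong bex_cong) (use nand ex in auto)
qed

lemma ex_sat_class:
  obtains T where "T \<in> carr N" "\<forall>c\<in>els N A. sec N T c = Phi c (sec N T)"
proof (rule N.recursion[OF A_in N.lev_trans[OF A(1)], of Phi])
  show "Phi x f = Phi x g" if "trans_class N u" "els N x \<subseteq> u" "\<forall>y\<in>u. f y = g y" for x u f g
    using that by (rule Phi_local)
  show "is_set N (Phi x (sec N T))" if "x \<in> els N A" "T \<in> carr N" for x T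
  proof (rule N.is_set_sep[OF is_set_env])
    show "dclass N (\<lambda>s. Phi x (sec N T))" by (intro defn that N.els_in_carr[OF that(1)])
  qed (auto simp: Phi_def)
  show "Phi x f \<subseteq> carr N" for x f by (auto simp: Phi_def env_def)
  show "definable N (\<lambda>s. s 0 \<in> Phi (s 1) (sec N (s 2)))" by (intro defn)
qed (use that in blast)

end

section \<open>The least new level and the truth lemma\<close>

locale sat_class = sat_ext M N A j for M N :: "'a eps_struct" and A j +
  fixes T :: 'a
  assumes T: "T \<in> carr N" and sec_T: "\<And>c. c \<in> els N A \<Longrightarrow> sec N T c = Phi c (sec N T)"
begin

abbreviation "F \<equiv> sec N T"
abbreviation "\<rho> \<equiv> rho (sec N T)"

text \<open>The statements in \<open>M\<close> whose level is new, by \<open>big_iff\<close>. This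
  form quantifies over \<open>M\<close> only and is therefore definable in \<open>M\<close> by
  conservativity.\<close>

definition big :: "'a set" where
  "big = {u \<in> carr M. carr M \<subseteq> \<rho> u}"

lemma pr_code_eq:
  assumes "x \<in> carr N" "y \<in> carr N" "z \<in> carr N" "w \<in> carr N"
  shows "pr N (j n) (pr N x y) = pr N (j m) (pr N z w) \<longleftrightarrow> n = m \<and> x = z \<and> y = w"
  using assms by (simp add: N.pr_in j_in j_eq)

section \<open>Satisfaction clauses for codes in \<open>M\<close>\<close>

lemma F_Mem:
  assumes "v \<in> carr M" "w \<in> carr M" "e \<in> env"
  shows "e \<in> F (pr N (j 0) (pr N v w)) \<longleftrightarrow>
    (\<exists>a\<in>carr N. \<exists>b\<in>carr N. pr N v a \<in> els N e \<and> pr N w b \<in> els N e \<and> a \<in> els N b)"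
  using assms unfolding sec_T[OF M_subset_A[OF pr_in_M[OF j_in(1) pr_in_M[OF assms(1,2)]]]] Phi_def
  by (auto simp: pr_code_eq N.pr_in carr_subset)

lemma F_Eq:
  assumes "v \<in> carr M" "w \<in> carr M" "e \<in> env"
  shows "e \<in> F (pr N (j 1) (pr N v w)) \<longleftrightarrow> (\<exists>a\<in>carr N. pr N v a \<in> els N e \<and> pr N w a \<in> els N e)"
  using assms unfolding sec_T[OF M_subset_A[OF pr_in_M[OF j_in(1) pr_in_M[OF assms(1,2)]]]] Phi_def
  by (auto simp: pr_code_eq N.pr_in carr_subset)

lemma F_Nand:
  assumes "c \<in> carr M" "d \<in> carr M" "e \<in> env"
  shows "e \<in> F (pr N (j 2) (pr N c d)) \<longleftrightarrow> \<not> (e \<in> F c \<and> e \<in> F d)"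
  using assms unfolding sec_T[OF M_subset_A[OF pr_in_M[OF j_in(1) pr_in_M[OF assms(1,2)]]]] Phi_def
  by (auto simp: pr_code_eq N.pr_in carr_subset)

lemma F_Ex:
  assumes "u \<in> carr M" "v \<in> carr M" "d \<in> carr M" "e \<in> env"
  shows "e \<in> F (pr N (j 3) (pr N u (pr N v d))) \<longleftrightarrow> (\<exists>a\<in>\<rho> u. upd N e v a \<in> F d)"
  using assms
  unfolding sec_T[OF M_subset_A[OF pr_in_M[OF j_in(1) pr_in_M[OF assms(1) pr_in_M[OF assms(2,3)]]]]] Phi_def
  by (auto simp: pr_code_eq N.pr_in carr_subset)

text \<open>Either there is no witnessing level and \<open>A\<close> serves, or the least one exists
  by \<open>lev_least\<close>, lies within \<open>A\<close>, and equals the intersection in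
  \<open>rho\<close>.\<close>

lemma rho_lev:
  assumes "u \<in> carr N"
  obtains G where "lev N G" "els N G = \<rho> u" "\<forall>L. lev N L \<and> wit F u L \<longrightarrow> wit F u G"
proof (cases "\<exists>L\<in>carr N. lev N L \<and> wit F u L")
  case False
  then have "\<rho> u = els N A" by (auto simp: rho_def)
  then show thesis by (intro that[OF A(1)]) (use False N.lev_in in auto)
next
  case True
  define P where "P = {L \<in> carr N. lev N L \<and> wit F u L}"
  have "dclass N (\<lambda>s. P)"
    unfolding P_def by (intro defn definable_3[OF definable_wit] T assms)
  moreover have "P \<noteq> {}" using True by (auto simp: P_def)
  moreover have "lev N r" if "r \<in> P" for r using that by (simp add: P_def)
  ultimately obtain r where r: "r \<in> P" "\<forall>q\<in>P. els N r \<subseteq> els N q" by (rule N.lev_least)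
  have lr: "lev N r" using r(1) by (simp add: P_def)
  obtain v c e b where w: "v \<in> carr N" "c \<in> carr N" "e \<in> carr N" "u = pr N v (pr N c e)"
    "b \<in> els N A" "upd N e v b \<in> F c"
    using r(1) by (auto simp: P_def wit_def)
  \<comment> \<open>The witness \<open>b\<close> is an element of the level \<open>A\<close>, so it
    is contained in an earlier level \<open>q\<close>; this \<open>q\<close> is witnessing and keeps
    \<open>r\<close> inside \<open>A\<close>.\<close>
  obtain q where q: "lev N q" "q \<in> els N A" "els N b \<subseteq> els N q" using N.lev_cover[OF A(1) w(5)] by blast
  have "q \<in> P" unfolding P_def wit_def using q w N.lev_in[OF q(1)] by blast
  then have "els N r \<subseteq> els N A" using r(2) N.lev_transD[OF A(1) q(2)] by blast
  then have "els N r = \<rho> u" using r unfolding rho_def P_def by blast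
  moreover have "wit F u r" using r(1) by (simp add: P_def)
  ultimately show thesis by (intro that[OF lr]) auto
qed

lemma big_iff:
  assumes "u \<in> carr M" "lev N G" "els N G = \<rho> u"
  shows "u \<in> big \<longleftrightarrow> G \<notin> carr M"
proof
  assume "u \<in> big"
  then show "G \<notin> carr M" using N.not_self_mem[OF N.lev_in[OF assms(2)]] assms(3) by (auto simp: big_def)
next
  assume "G \<notin> carr M"
  then show "u \<in> big" using new_lev_above[OF assms(2)] assms by (auto simp: big_def)
qed

lemma big_nonempty: "big \<noteq> {}"
proof -
  \<comment> \<open>The empty set is not a pair, so it codes no statement and receives the default
    level \<open>A\<close>.\<close>
  define u where "u = cd M {}"
  have u: "u \<in> carr M" "els N u = {}"
    using M.cd_in[OF M.is_set_empty] M.els_cd[OF M.is_set_empty] by (simp_all add: u_def els_ext)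
  have "u \<noteq> pr N x y" if "x \<in> carr N" "y \<in> carr N" for x y
    using N.els_pr[OF that] u by auto
  then have "\<not> wit F u L" for L by (auto simp: wit_def N.pr_in)
  then have "\<rho> u = els N A" by (auto simp: rho_def)
  then have "u \<in> big" using u M_subset_A by (auto simp: big_def)
  then show ?thesis by blast
qed

lemma definable_rho_M: "definable M (\<lambda>s. s 0 \<in> \<rho> (s 1))"
  by (rule definable_cons) (intro defn T)

lemma definable_rho_subset_M: "definable M (\<lambda>s. \<rho> (s 0) \<subseteq> \<rho> (s 1))"
  by (rule definable_cons) (intro defn T)

lemma dclass_big: "dclass M (\<lambda>s. big)"
proof -
  have "dclass M (\<lambda>s. {u \<in> carr M. \<forall>x\<in>carr M. x \<in> \<rho> u})"
    by (intro dclass_Collect definable_all definable_2[OF definable_rho_M] M.dterm_var')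
  then show ?thesis by (simp add: big_def subset_eq)
qed

text \<open>A set of \<open>M\<close> is also a set of \<open>N\<close>, so the levels
  \<open>\<rho> u\<close> with \<open>u\<close> in \<open>S\<close> form a class of
  \<open>N\<close>, to which \<open>lev_least\<close> applies. For \<open>big\<close> itself this
  argument is not at hand, as \<open>carr M\<close> is not given as a class of
  \<open>N\<close>.\<close>

lemma big_set_least:
  assumes S: "is_set M S" "S \<noteq> {}" "S \<subseteq> big"
  obtains u where "u \<in> S" "\<forall>v\<in>S. \<rho> u \<subseteq> \<rho> v"
proof -
  have SM: "S \<subseteq> carr M" using M.is_set_subset[OF S(1)] .
  define P where "P = {G \<in> carr N. lev N G \<and> (\<exists>u\<in>S. els N G = \<rho> u)}"
  have "dclass N (\<lambda>s. P)"
    unfolding P_def by (intro defn T N.dclass_is_set[OF is_set_ext(1)[OF S(1)]])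
  moreover have "P \<noteq> {}"
  proof -
    obtain u where u: "u \<in> S" using S(2) by blast
    then have "u \<in> carr N" using SM carr_subset by blast
    then obtain G where "lev N G" "els N G = \<rho> u" by (rule rho_lev)
    then show ?thesis using u N.lev_in by (auto simp: P_def)
  qed
  moreover have "lev N r" if "r \<in> P" for r using that by (simp add: P_def)
  ultimately obtain r where r: "r \<in> P" "\<forall>q\<in>P. els N r \<subseteq> els N q" by (rule N.lev_least)
  obtain u where u: "u \<in> S" "els N r = \<rho> u" using r(1) by (auto simp: P_def)
  have "\<rho> u \<subseteq> \<rho> v" if v: "v \<in> S" for v
  proof -
    have "v \<in> carr N" using SM carr_subset v by blast
    then obtain G where "lev N G" "els N G = \<rho> v" by (rule rho_lev)
    then have "G \<in> P" "els N G = \<rho> v" using v N.lev_in by (auto simp: P_def)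
    then show ?thesis using r(2) u by blast
  qed
  then show thesis using that u by blast
qed

lemma big_least:
  obtains u where "u \<in> big" "\<forall>v\<in>big. \<rho> u \<subseteq> \<rho> v"
proof (rule ccontr)
  assume "\<not> thesis"
  then have "\<not> (\<exists>u\<in>big. \<forall>v\<in>big. \<rho> u \<subseteq> \<rho> v)" using that by blast
  then have no_min: "\<exists>v\<in>big. \<not> \<rho> u \<subseteq> \<rho> v" if "u \<in> big" for u using that by blast
  \<comment> \<open>Every set of \<open>M\<close> can be undercut: its least level within
    \<open>big\<close> is not least in all of \<open>big\<close>.\<close>
  have below: "\<exists>v\<in>big. \<forall>u\<in>Y \<inter> big. \<not> \<rho> u \<subseteq> \<rho> v" if Y: "is_set M Y" for Y
  proof (cases "Y \<inter> big = {}")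
    case True
    then show ?thesis using big_nonempty by blast
  next
    case False
    obtain u where u: "u \<in> Y \<inter> big" "\<forall>v\<in>Y \<inter> big. \<rho> u \<subseteq> \<rho> v"
      by (rule big_set_least[OF M.is_set_Int[OF Y dclass_big] False]) auto
    then obtain v where "v \<in> big" "\<not> \<rho> u \<subseteq> \<rho> v" using no_min by blast
    then show ?thesis using u by blast
  qed
  obtain w where w: "w \<in> carr M" "trans_class M (els M w)" "els M w \<noteq> {}"
    "\<And>n. n \<in> els M w \<Longrightarrow> \<exists>m\<in>els M w. n \<in> els M m" using M.limit_set by metis
  \<comment> \<open>Without choice the recursion collects whole levels instead of single codes: the
    value at \<open>n\<close> is the least level \<open>K\<close> of \<open>M\<close> containing
    some \<open>v\<close> in \<open>big\<close> that undercuts all codes of earlier steps.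
    \<open>\<Psi>\<close> expresses this least level as an intersection.\<close>
  define Q where "Q n f K \<longleftrightarrow> lev M K \<and> (\<exists>v\<in>els M K \<inter> big. \<forall>m\<in>els M n. \<forall>u\<in>f m \<inter> big. \<not> \<rho> u \<subseteq> \<rho> v)"
    for n f K
  define \<Psi> where "\<Psi> n f = {x \<in> carr M. \<forall>K\<in>carr M. Q n f K \<longrightarrow> x \<in> els M K}" for n f
  have dQ: "definable M (\<lambda>s. Q (s 0) (sec M (s 1)) (s 2))"
    unfolding Q_def by (intro defn dclass_big definable_2[OF definable_rho_subset_M])
  have ex_Q: "\<exists>K\<in>carr M. Q n (sec M S) K" if nS: "n \<in> carr M" "S \<in> carr M" for n S
  proof -
    define Y where "Y = (\<Union>x\<in>(\<Union>x\<in>els M S. els M x). els M x)"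
    have "is_set M Y" unfolding Y_def by (rule M.is_set_sec_bound[OF nS(2)])
    then obtain v where v: "v \<in> big" "\<forall>u\<in>Y \<inter> big. \<not> \<rho> u \<subseteq> \<rho> v" using below by blast
    have "v \<in> carr M" using v by (auto simp: big_def)
    then obtain K where K: "lev M K" "v \<in> els M K" by (rule M.ex_lev)
    have "sec M S m \<subseteq> Y" if "m \<in> els M n" for m
      unfolding Y_def by (rule M.sec_bounded[OF M.els_in_carr[OF that]])
    then have "Q n (sec M S) K" unfolding Q_def using K v by blast
    then show ?thesis using M.lev_in[OF K(1)] by blast
  qed
  obtain S where S: "S \<in> carr M" "\<And>n. n \<in> els M w \<Longrightarrow> sec M S n = \<Psi> n (sec M S)"
  proof (rule M.recursion[OF w(1,2), of \<Psi>])
    show "\<Psi> x f = \<Psi> x g" if "els M x \<subseteq> u" "\<forall>y\<in>u. f y = g y" for x u f g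
    proof -
      have "f m = g m" if "m \<in> els M x" for m using that \<open>els M x \<subseteq> u\<close> \<open>\<forall>y\<in>u. f y = g y\<close> by blast
      then show ?thesis by (simp add: \<Psi>_def Q_def)
    qed
    show "\<Psi> x f \<subseteq> carr M" for x f by (auto simp: \<Psi>_def)
    show "definable M (\<lambda>s. s 0 \<in> \<Psi> (s 1) (sec M (s 2)))"
      unfolding \<Psi>_def by (intro defn definable_3[OF dQ])
    show "is_set M (\<Psi> n (sec M S))" if nS: "n \<in> els M w" "S \<in> carr M" for n S
    proof -
      have n: "n \<in> carr M" by (rule M.els_in_carr[OF nS(1)])
      obtain K where K: "K \<in> carr M" "Q n (sec M S) K" using ex_Q[OF n nS(2)] by blast
      show ?thesis
      proof (rule M.is_set_sep[OF M.is_set_els[OF K(1)]])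
        show "\<Psi> n (sec M S) \<subseteq> els M K" using K by (auto simp: \<Psi>_def)
        show "dclass M (\<lambda>s. \<Psi> n (sec M S))"
          unfolding \<Psi>_def by (intro defn definable_3[OF dQ] n nS(2))
      qed
    qed
  qed blast
  have step: "\<exists>v\<in>sec M S n \<inter> big. \<forall>m\<in>els M n. \<forall>u\<in>sec M S m \<inter> big. \<not> \<rho> u \<subseteq> \<rho> v"
    if n: "n \<in> els M w" for n
  proof -
    have nM: "n \<in> carr M" by (rule M.els_in_carr[OF n])
    define P where "P = {K \<in> carr M. Q n (sec M S) K}"
    have "dclass M (\<lambda>s. P)" unfolding P_def by (intro defn definable_3[OF dQ] nM S(1))
    moreover have "P \<noteq> {}" using ex_Q[OF nM S(1)] by (auto simp: P_def)
    moreover have "lev M r" if "r \<in> P" for r using that by (simp add: P_def Q_def)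
    ultimately obtain r where r: "r \<in> P" "\<forall>q\<in>P. els M r \<subseteq> els M q" by (rule M.lev_least)
    have "els M r \<subseteq> \<Psi> n (sec M S)" using r(2) M.els_in_carr by (auto simp: \<Psi>_def P_def)
    moreover have "\<Psi> n (sec M S) \<subseteq> els M r" using r(1) by (auto simp: \<Psi>_def P_def)
    ultimately have "sec M S n = els M r" using S(2)[OF n] by blast
    then show ?thesis using r(1) by (simp add: P_def Q_def)
  qed
  \<comment> \<open>The descending sequence is a set of \<open>M\<close>, so
    \<open>big_set_least\<close> gives it a least level.\<close>
  define X where "X = {v \<in> carr M. \<exists>n\<in>els M w. v \<in> sec M S n \<inter> big}"
  have "is_set M X"
  proof (rule M.is_set_sep[OF M.is_set_sec_bound[OF S(1)]])
    show "X \<subseteq> (\<Union>x\<in>(\<Union>x\<in>els M S. els M x). els M x)"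
      unfolding X_def using M.sec_bounded[OF M.els_in_carr, of _ w S] by blast
    show "dclass M (\<lambda>s. X)" unfolding X_def by (intro defn w(1) S(1) dclass_big)
  qed
  moreover have "X \<noteq> {}"
  proof -
    obtain n where n: "n \<in> els M w" using w(3) by blast
    then obtain v where "v \<in> sec M S n \<inter> big" using step by blast
    then show ?thesis using n by (auto simp: X_def big_def)
  qed
  moreover have "X \<subseteq> big" by (auto simp: X_def)
  ultimately obtain u where u: "u \<in> X" "\<forall>v\<in>X. \<rho> u \<subseteq> \<rho> v" by (rule big_set_least)
  then obtain n where n: "n \<in> els M w" "u \<in> sec M S n \<inter> big" by (auto simp: X_def)
  \<comment> \<open>The limit property of \<open>w\<close> provides a later step, and some code
    collected there undercuts the least one \<open>u\<close>.\<close>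
  then obtain m where m: "m \<in> els M w" "n \<in> els M m" using w(4) by blast
  obtain v where v: "v \<in> sec M S m \<inter> big" "\<not> \<rho> u \<subseteq> \<rho> v" using step[OF m(1)] m(2) n(2) by blast
  then have "v \<in> X" using m(1) by (auto simp: X_def big_def)
  then show False using u(2) v(2) by blast
qed

text \<open>The equivalence ranges over all of \<open>carr N\<close>, so that the relation
  \<open>e\<close> has exactly one value at each variable \<open>j n\<close> in question.\<close>

definition agree :: "'a \<Rightarrow> (nat \<Rightarrow> 'a) \<Rightarrow> nat set \<Rightarrow> bool" where
  "agree e s X \<longleftrightarrow> (\<forall>n\<in>X. \<forall>a\<in>carr N. pr N (j n) a \<in> els N e \<longleftrightarrow> a = s n)"

lemma agree_upd:
  assumes "agree e s (X - {x})" "e \<in> carr N" "a \<in> carr N"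
  shows "agree (upd N e (j x) a) (s(x := a)) X"
  using assms unfolding agree_def
  by (auto simp: N.els_upd j_in N.pr_in j_eq)

lemma env_upd:
  assumes "e \<in> env" "a \<in> els N A"
  shows "upd N e (j x) a \<in> env"
proof -
  have *: "e \<in> carr N" "a \<in> carr N" "j x \<in> els N A"
    using assms N.els_in_carr M_subset_A[OF j_in(1)] by (auto simp: env_def)
  have "pr N (j x) a \<in> N.times (els N A) (els N A)"
    using assms * by (simp add: N.pr_in_times j_in els_subset)
  then show ?thesis
    using assms * unfolding env_def by (auto simp: N.els_upd N.upd_in j_in)
qed

text \<open>Finitely many updates of the empty assignment stay in \<open>M\<close> by
  \<open>upd_in_M\<close>.\<close>

lemma ex_env:
  assumes "finite X" "range s \<subseteq> carr M"
  shows "\<exists>e\<in>carr M. e \<in> env \<and> agree e s X"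
  using assms(1)
proof (induction rule: finite_induct)
  case empty
  have e: "cd M {} \<in> carr M" "els N (cd M {}) = {}"
    using M.cd_in[OF M.is_set_empty] M.els_cd[OF M.is_set_empty] by (simp_all add: els_ext)
  then show ?case by (intro bexI[of _ "cd M {}"]) (auto simp: env_def agree_def carr_subset)
next
  case (insert x X)
  then obtain e where e: "e \<in> carr M" "e \<in> env" "agree e s X" by blast
  have sx: "s x \<in> carr M" using assms(2) by auto
  have "agree (upd N e (j x) (s x)) (s(x := s x)) (insert x X)"
    by (rule agree_upd) (use e sx insert.hyps in \<open>auto simp: agree_def carr_subset\<close>)
  then show ?case
    using e sx by (intro bexI[of _ "upd N e (j x) (s x)"])
      (auto intro!: env_upd upd_in_M simp: j_in M_subset_A)
qed

text \<open>The code \<open>c\<close> depends only on the formula, and all its quantifiers are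
  bounded by the least new level \<open>\<rho> u\<close>. The decisive point is the quantifier case,
  where a witness in \<open>\<rho> u\<close> has to be traded for one in \<open>M\<close>.\<close>

lemma truth:
  assumes u: "u \<in> big" "\<forall>v\<in>big. \<rho> u \<subseteq> \<rho> v"
  shows "\<exists>c\<in>carr M. \<forall>s e. range s \<subseteq> carr M \<longrightarrow> e \<in> carr M \<longrightarrow> e \<in> env \<longrightarrow> agree e s (fv p) \<longrightarrow>
    (e \<in> F c \<longleftrightarrow> sat M s p)"
proof (induction p)
  case (Mem x y)
  show ?case
  proof (intro bexI allI impI)
    show "pr N (j 0) (pr N (j x) (j y)) \<in> carr M" by (intro pr_in_M j_in)
    fix s e
    assume *: "range s \<subseteq> carr M" "e \<in> carr M" "e \<in> env" "agree e s (fv (Mem x y))"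
    then have s: "s x \<in> carr M" "s y \<in> carr M" by auto
    then have "e \<in> F (pr N (j 0) (pr N (j x) (j y))) \<longleftrightarrow> s x \<in> els N (s y)"
      using * by (auto simp: F_Mem j_in agree_def carr_subset)
    also have "\<dots> \<longleftrightarrow> eps M (s x) (s y)" using s by (simp add: els_ext) (simp add: els_def)
    finally show "e \<in> F (pr N (j 0) (pr N (j x) (j y))) \<longleftrightarrow> sat M s (Mem x y)" by simp
  qed
next
  case (Eq x y)
  show ?case
  proof (intro bexI allI impI)
    show "pr N (j 1) (pr N (j x) (j y)) \<in> carr M" by (intro pr_in_M j_in)
    fix s e
    assume *: "range s \<subseteq> carr M" "e \<in> carr M" "e \<in> env" "agree e s (fv (Eq x y))"
    then have s: "s x \<in> carr M" "s y \<in> carr M" by auto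
    then show "e \<in> F (pr N (j 1) (pr N (j x) (j y))) \<longleftrightarrow> sat M s (Eq x y)"
      using * F_Eq[OF j_in(1) j_in(1) *(3)] by (auto simp: agree_def carr_subset)
  qed
next
  case (Neg p)
  then obtain c where c: "c \<in> carr M" "\<And>s e. range s \<subseteq> carr M \<Longrightarrow> e \<in> carr M \<Longrightarrow> e \<in> env \<Longrightarrow>
    agree e s (fv p) \<Longrightarrow> (e \<in> F c \<longleftrightarrow> sat M s p)" by blast
  show ?case
  proof (intro bexI allI impI)
    show "pr N (j 2) (pr N c c) \<in> carr M" by (intro pr_in_M j_in c)
    fix s e
    assume *: "range s \<subseteq> carr M" "e \<in> carr M" "e \<in> env" "agree e s (fv (Neg p))"
    then show "e \<in> F (pr N (j 2) (pr N c c)) \<longleftrightarrow> sat M s (Neg p)"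
      using c(2)[OF *(1,2,3)] F_Nand[OF c(1) c(1) *(3)] by simp
  qed
next
  case (Conj p q)
  then obtain c d where c: "c \<in> carr M" "\<And>s e. range s \<subseteq> carr M \<Longrightarrow> e \<in> carr M \<Longrightarrow> e \<in> env \<Longrightarrow>
    agree e s (fv p) \<Longrightarrow> (e \<in> F c \<longleftrightarrow> sat M s p)"
    and d: "d \<in> carr M" "\<And>s e. range s \<subseteq> carr M \<Longrightarrow> e \<in> carr M \<Longrightarrow> e \<in> env \<Longrightarrow>
    agree e s (fv q) \<Longrightarrow> (e \<in> F d \<longleftrightarrow> sat M s q)" by blast
  \<comment> \<open>The not-and of a code with itself is its negation, so a conjunction is a negated
    not-and.\<close>
  let ?c = "pr N (j 2) (pr N c d)"
  have cM: "?c \<in> carr M" by (intro pr_in_M j_in c d)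
  show ?case
  proof (intro bexI allI impI)
    show "pr N (j 2) (pr N ?c ?c) \<in> carr M" by (intro pr_in_M j_in cM)
    fix s e
    assume *: "range s \<subseteq> carr M" "e \<in> carr M" "e \<in> env" "agree e s (fv (Conj p q))"
    then have "agree e s (fv p)" "agree e s (fv q)" by (auto simp: agree_def)
    then show "e \<in> F (pr N (j 2) (pr N ?c ?c)) \<longleftrightarrow> sat M s (Conj p q)"
      using c(2)[OF *(1,2,3)] d(2)[OF *(1,2,3)] F_Nand[OF cM cM *(3)] F_Nand[OF c(1) d(1) *(3)] by simp
  qed
next
  case (Exists x p)
  then obtain c where c: "c \<in> carr M" "\<And>s e. range s \<subseteq> carr M \<Longrightarrow> e \<in> carr M \<Longrightarrow> e \<in> env \<Longrightarrow>
    agree e s (fv p) \<Longrightarrow> (e \<in> F c \<longleftrightarrow> sat M s p)" by blast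
  have uM: "u \<in> carr M" "carr M \<subseteq> \<rho> u" using u(1) by (auto simp: big_def)
  show ?case
  proof (intro bexI allI impI)
    let ?c = "pr N (j 3) (pr N u (pr N (j x) c))"
    show "?c \<in> carr M" by (intro pr_in_M j_in c uM)
    fix s e
    assume *: "range s \<subseteq> carr M" "e \<in> carr M" "e \<in> env" "agree e s (fv (Exists x p))"
    have IH: "upd N e (j x) a \<in> F c \<longleftrightarrow> sat M (s(x := a)) p" if a: "a \<in> carr M" for a
    proof (rule c(2))
      show "range (s(x := a)) \<subseteq> carr M" using *(1) a by auto
      show "upd N e (j x) a \<in> carr M" by (intro upd_in_M * j_in a)
      show "upd N e (j x) a \<in> env" by (intro env_upd * M_subset_A a)
      show "agree (upd N e (j x) a) (s(x := a)) (fv p)"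
        using * a by (intro agree_upd) (auto simp: carr_subset)
    qed
    have "(\<exists>a\<in>\<rho> u. upd N e (j x) a \<in> F c) \<longleftrightarrow> (\<exists>a\<in>carr M. upd N e (j x) a \<in> F c)"
    proof
      assume "\<exists>a\<in>\<rho> u. upd N e (j x) a \<in> F c"
      then obtain a where a: "a \<in> \<rho> u" "upd N e (j x) a \<in> F c" by blast
      obtain \<gamma> where \<gamma>: "lev N \<gamma>" "els N \<gamma> = \<rho> u" by (rule rho_lev[OF carr_subset[OF uM(1)]])
      obtain q where q: "lev N q" "q \<in> els N \<gamma>" "els N a \<subseteq> els N q"
        using N.lev_cover[OF \<gamma>(1)] a(1) \<gamma>(2) by blast
      \<comment> \<open>\<open>v\<close> codes the existential statement that \<open>a\<close> has
        verified, and it lies in \<open>M\<close> because \<open>c\<close> and \<open>e\<close> do.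
        The level \<open>q\<close> witnesses it.\<close>
      define v where "v = pr N (j x) (pr N c e)"
      have vM: "v \<in> carr M" unfolding v_def by (intro pr_in_M j_in c *)
      obtain G where G: "lev N G" "els N G = \<rho> v" and wG: "\<forall>L. lev N L \<and> wit F v L \<longrightarrow> wit F v G"
        by (rule rho_lev[OF carr_subset[OF vM]])
      have aA: "a \<in> els N A" using a(1) by (simp add: rho_def)
      have wq: "wit F v q"
        unfolding wit_def v_def using q(3) aA a(2) j_in(2) carr_subset c(1) *(2) by blast
      \<comment> \<open>Since \<open>q\<close> is an element of \<open>\<rho> u\<close> but not of
        itself, \<open>\<rho> v\<close> is strictly below \<open>\<rho> u\<close>. By minimality
        \<open>v\<close> is not in \<open>big\<close>, and its level \<open>G\<close> belongs to
        \<open>M\<close>.\<close>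
      then have "\<rho> v \<subseteq> els N q" using N.lev_in[OF q(1)] q(1) by (auto simp: rho_def)
      moreover have "q \<notin> els N q" using N.not_self_mem[OF N.lev_in[OF q(1)]] .
      ultimately have "\<not> \<rho> u \<subseteq> \<rho> v" using q(2) \<gamma>(2) by blast
      then have "v \<notin> big" using u(2) by blast
      then have GM: "G \<in> carr M" using big_iff[OF vM G] by blast
      have "wit F v G" using wG q(1) wq by blast
      then obtain b where b: "b \<in> els N A" "els N b \<subseteq> els N G" "upd N e (j x) b \<in> F c"
        unfolding wit_def v_def
        by (auto simp: N.pr_in carr_subset c(1) *(2) j_in)
      \<comment> \<open>The new witness is a subset of an element of \<open>M\<close>.\<close>
      then have "b \<in> carr M" using subset_in_M[OF N.els_in_carr GM] by blast
      then show "\<exists>a\<in>carr M. upd N e (j x) a \<in> F c" using b by blast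
    qed (use uM in blast)
    then show "e \<in> F ?c \<longleftrightarrow> sat M s (Exists x p)"
      using IH F_Ex[OF uM(1) j_in(1) c(1) *(3), of x] by auto
  qed
qed

end

context sat_class
begin

text \<open>Tarski's diagonal argument, with codes \<open>(c, (e, v))\<close> for the set of all \<open>a\<close> such that the
  formula \<open>c\<close> holds under the assignment \<open>e\<close> updated by \<open>v := a\<close>.\<close>

lemma contradiction: False
proof -
  obtain u where u: "u \<in> big" "\<forall>v\<in>big. \<rho> u \<subseteq> \<rho> v" by (rule big_least)
  define D where "D = {a \<in> carr N. \<exists>c\<in>carr N. \<exists>e\<in>carr N. \<exists>v\<in>carr N.
    a = pr N c (pr N e v) \<and> upd N e v a \<notin> F c}"
  have "dclass N (\<lambda>s. D)" unfolding D_def by (intro defn T)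
  from dclass_cons[OF this] M.carr_ne obtain p s where s: "range s \<subseteq> carr M"
    and p: "D \<inter> carr M = {a \<in> carr M. sat M (s(0 := a)) p}"
    by (rule dclass_formula)
  obtain c where c: "c \<in> carr M" and truth_c: "\<And>s e. range s \<subseteq> carr M \<Longrightarrow> e \<in> carr M \<Longrightarrow> e \<in> env \<Longrightarrow>
      agree e s (fv p) \<Longrightarrow> (e \<in> F c \<longleftrightarrow> sat M s p)"
    using truth[OF u, of p] by blast
  obtain e where e: "e \<in> carr M" "e \<in> env" "agree e s (fv p)" using ex_env[OF finite_fv s] by blast
  \<comment> \<open>Since \<open>c\<close> codes the formula \<open>p\<close> that defines
    \<open>D\<close> on \<open>M\<close>, with \<open>j 0\<close> as the variable of the tested
    element, \<open>a\<close> refers to its own membership in \<open>D\<close>.\<close>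
  define a where "a = pr N c (pr N e (j 0))"
  have a: "a \<in> carr M" unfolding a_def by (intro pr_in_M c e j_in)
  have "a \<in> D \<longleftrightarrow> upd N e (j 0) a \<notin> F c"
    unfolding D_def using a c e j_in[of 0] by (auto simp: a_def carr_subset N.pr_in)
  moreover have "upd N e (j 0) a \<in> F c \<longleftrightarrow> sat M (s(0 := a)) p"
  proof (rule truth_c)
    show "range (s(0 := a)) \<subseteq> carr M" using s a by auto
    show "upd N e (j 0) a \<in> carr M" by (intro upd_in_M e j_in a)
    show "upd N e (j 0) a \<in> env" by (intro env_upd e M_subset_A a)
    show "agree (upd N e (j 0) a) (s(0 := a)) (fv p)"
      by (rule agree_upd) (use e a in \<open>auto simp: agree_def carr_subset\<close>)
  qed
  moreover have "a \<in> D \<longleftrightarrow> sat M (s(0 := a)) p" using p a by blast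
  ultimately show False by blast
qed

end

theorem theorem5p1:
  fixes M :: "'a eps_struct"
  assumes "models M ZF"
  shows "\<not> (\<exists>N :: 'a eps_struct. proper_end_extension M N \<and> models N ZF \<and> conservative_extension M N)"
proof
  assume "\<exists>N :: 'a eps_struct. proper_end_extension M N \<and> models N ZF \<and> conservative_extension M N"
  then obtain N :: "'a eps_struct" where
    N: "proper_end_extension M N" "models N ZF" "conservative_extension M N" by blast
  interpret cons_ext M N by unfold_locales (use assms N in auto)
  obtain A where A: "lev N A" "A \<notin> carr M" by (rule ex_new_lev)
  obtain j :: "nat \<Rightarrow> 'a" where j: "inj j" "range j \<subseteq> carr M"
    using infinite_countable_subset[OF M.infinite_carr] by blast
  interpret sat_ext M N A j by unfold_locales (use A j in auto)
  obtain T where T: "T \<in> carr N" "\<forall>c\<in>els N A. sec N T c = Phi c (sec N T)"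
    by (rule ex_sat_class)
  interpret sat_class M N A j T by unfold_locales (use T in auto)
  show False by (rule contradiction)
qed

end
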